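(* Let $M^n$ be a Riemannian manifold and let $TM^n$ be its tangent bundle endowed with the Sasaki metric. Consider a cylinder-type surface $\tilde F^2\subset TM^n$ parameterized as $$\big\{\gamma(s),\; t\,\rho(s)\,e(s)\big\},$$ where $\gamma(s)$ is a geodesic in $M^n$, $e(s)$ is a unit vector field, parallel along $\gamma$, and $\rho(s)$ is an arbitrary smooth function. Then $\tilde F^2$ is totally geodesic in $TM^n$ and intrinsically flat.
   Context: The notation $\{\gamma(s),t\rho(s)e(s)\}$ means the set of points $(q,\xi)\in TM^n$ with $q=\gamma(s)$ and $\xi=t\rho(s)e(s)\in T_{\gamma(s)}M^n$, with real parameters $s$ and $t$. Intrinsically flat means that the Gaussian curvature of $\tilde F^2$ in the induced metric vanishes. Let $\pi:TM\to M$ be the bundle projection of the tangent bundle of a Riemannian manifold $(M,g)$ of dimension $n$. The Sasaki metric on $TM$ is $\langle\langle \tilde X,\tilde Y\rangle\rangle=\langle \pi_*\tilde X,\pi_*\tilde Y\rangle+\langle \mathcal K\tilde X,\mathcal K\tilde Y\rangle$, where $\langle\cdot,\cdot\rangle=g$ and $\mathcal K:TTM\to TM$ is the connection map; in induced local coordinates $(x^i,\xi^i)$ on $TM$, for $\tilde X=\tilde X^i\frac{\partial}{\partial x^i}+\tilde X^{n+i}\frac{\partial}{\partial \xi^i}$ at the point $(q,\xi)$ (with $\partial_i=\partial/\partial x^i$ the coordinate frame on $M$ and $\Gamma^i_{jk}$ the Christoffel symbols of $g$), one has $\pi_*\tilde X=\tilde X^i\partial_i$ and $\mathcal K\tilde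 X=(\tilde X^{n+i}+\Gamma^i_{jk}(q)\xi^j\tilde X^k)\partial_i$. *)

theory Defs
  imports "HOL-Analysis.Analysis"
begin

section \<open>Smooth maps between Euclidean spaces\<close>

text \<open>Derivatives are full derivatives \<open>at x\<close>, so these notions are meant for open sets.\<close>

primrec Ck_on :: "nat \<Rightarrow> 'p::euclidean_space set \<Rightarrow> ('p \<Rightarrow> 'b::real_normed_vector) \<Rightarrow> bool" where
  "Ck_on 0 S f \<longleftrightarrow> continuous_on S f"
| "Ck_on (Suc k) S f \<longleftrightarrow>
     (\<forall>x\<in>S. f differentiable (at x)) \<and>
     (\<forall>v. Ck_on k S (\<lambda>x. frechet_derivative f (at x) v))"

definition smooth_on :: "'p::euclidean_space set \<Rightarrow> ('p \<Rightarrow> 'b::real_normed_vector) \<Rightarrow> bool" where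
  "smooth_on S f \<longleftrightarrow> (\<forall>k. Ck_on k S f)"


section \<open>Riemannian geometry in a coordinate domain\<close>

definition metric_form :: "real^'n^'n \<Rightarrow> real^'n \<Rightarrow> real^'n \<Rightarrow> real" where
  "metric_form G v w = v \<bullet> (G *v w)"

definition pd :: "'n::finite \<Rightarrow> (real^'n \<Rightarrow> real) \<Rightarrow> real^'n \<Rightarrow> real" where
  "pd i f x = frechet_derivative f (at x) (axis i 1)"

text \<open>\<open>christoffel G x k i j\<close> is \<open>\<Gamma>\<^sup>k\<^sub>i\<^sub>j\<close> at \<open>x\<close>.\<close>

definition christoffel :: "(real^'n \<Rightarrow> real^'n^'n) \<Rightarrow> real^'n \<Rightarrow> 'n::finite \<Rightarrow> 'n \<Rightarrow> 'n \<Rightarrow> real" where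
  "christoffel G x k i j =
     (1/2) * (\<Sum>l\<in>UNIV. matrix_inv (G x) $ k $ l *
        (pd i (\<lambda>y. G y $ j $ l) x + pd j (\<lambda>y. G y $ i $ l) x - pd l (\<lambda>y. G y $ i $ j) x))"

definition christoffel_map :: "(real^'n \<Rightarrow> real^'n^'n) \<Rightarrow> real^'n \<Rightarrow> real^'n \<Rightarrow> real^'n \<Rightarrow> real^'n::finite" where
  "christoffel_map G x v w = (\<chi> k. \<Sum>i\<in>UNIV. \<Sum>j\<in>UNIV. christoffel G x k i j * v $ i * w $ j)"

text \<open>\<open>riemann G x l k i j\<close> is the \<open>l\<close>-th component of \<open>R(\<partial>\<^sub>i, \<partial>\<^sub>j)\<partial>\<^sub>k\<close>, where
  \<open>R(X,Y)Z = \<nabla>\<^sub>X\<nabla>\<^sub>Y Z - \<nabla>\<^sub>Y\<nabla>\<^sub>X Z - \<nabla>\<^bsub>[X,Y]\<^esub> Z\<close>.\<close>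

definition riemann :: "(real^'n \<Rightarrow> real^'n^'n) \<Rightarrow> real^'n \<Rightarrow> 'n::finite \<Rightarrow> 'n \<Rightarrow> 'n \<Rightarrow> 'n \<Rightarrow> real" where
  "riemann G x l k i j =
     pd i (\<lambda>y. christoffel G y l j k) x - pd j (\<lambda>y. christoffel G y l i k) x
     + (\<Sum>m\<in>UNIV. christoffel G x l i m * christoffel G x m j k
                  - christoffel G x l j m * christoffel G x m i k)"

text \<open>The Gaussian curvature \<open>\<langle>R(\<partial>\<^sub>1, \<partial>\<^sub>2)\<partial>\<^sub>2, \<partial>\<^sub>1\<rangle> / det G\<close> of a two-dimensional metric.\<close>

definition gaussian_curvature :: "(real^2 \<Rightarrow> real^2^2) \<Rightarrow> real^2 \<Rightarrow> real" where
  "gaussian_curvature G x = (\<Sum>l\<in>UNIV. G x $ 1 $ l * riemann G x l 2 1 2) / det (G x)"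


section \<open>Riemannian manifolds\<close>

text \<open>A manifold is given by an indexed atlas on the union of the chart domains, which carries the
  topology induced by the charts; the metric is a tensor field given by its matrix of components
  in every chart.\<close>

record ('i, 'a, 'n::finite) riemannian =
  charts :: "'i set"
  chart_dom :: "'i \<Rightarrow> 'a set"
  chart_map :: "'i \<Rightarrow> 'a \<Rightarrow> real^'n"
  metric :: "'i \<Rightarrow> real^'n \<Rightarrow> real^'n^'n"

definition points :: "('i, 'a, 'n::finite) riemannian \<Rightarrow> 'a set" where
  "points M = (\<Union>i\<in>charts M. chart_dom M i)"

definition chart_inv :: "('i, 'a, 'n::finite) riemannian \<Rightarrow> 'i \<Rightarrow> real^'n \<Rightarrow> 'a" where
  "chart_inv M i = inv_into (chart_dom M i) (chart_map M i)"

definition transition :: "('i, 'a, 'n::finite) riemannian \<Rightarrow> 'i \<Rightarrow> 'i \<Rightarrow> real^'n \<Rightarrow> real^'n" where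
  "transition M i j = chart_map M j \<circ> chart_inv M i"

definition smooth_atlas :: "('i, 'a, 'n::finite) riemannian \<Rightarrow> bool" where
  "smooth_atlas M \<longleftrightarrow>
     (\<forall>i\<in>charts M. inj_on (chart_map M i) (chart_dom M i)) \<and>
     (\<forall>i\<in>charts M. \<forall>j\<in>charts M.
        open (chart_map M i ` (chart_dom M i \<inter> chart_dom M j)) \<and>
        smooth_on (chart_map M i ` (chart_dom M i \<inter> chart_dom M j)) (transition M i j))"

definition manifold_open :: "('i, 'a, 'n::finite) riemannian \<Rightarrow> 'a set \<Rightarrow> bool" where
  "manifold_open M W \<longleftrightarrow>
     W \<subseteq> points M \<and> (\<forall>i\<in>charts M. open (chart_map M i ` (W \<inter> chart_dom M i)))"

definition manifold_topology :: "('i, 'a, 'n::finite) riemannian \<Rightarrow> 'a topology" where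
  "manifold_topology M = topology (manifold_open M)"

lemma openin_manifold_topology:
  assumes "smooth_atlas M"
  shows "openin (manifold_topology M) = manifold_open M"
proof -
  have "istopology (manifold_open M)"
    unfolding istopology_def
  proof (intro conjI allI impI)
    fix S T assume S: "manifold_open M S" and T: "manifold_open M T"
    show "manifold_open M (S \<inter> T)"
      unfolding manifold_open_def
    proof (intro conjI ballI)
      show "S \<inter> T \<subseteq> points M" using S by (auto simp: manifold_open_def)
      fix i assume i: "i \<in> charts M"
      then have "inj_on (chart_map M i) (chart_dom M i)"
        using assms by (auto simp: smooth_atlas_def)
      then have "chart_map M i ` (S \<inter> T \<inter> chart_dom M i) =
          chart_map M i ` (S \<inter> chart_dom M i) \<inter> chart_map M i ` (T \<inter> chart_dom M i)"
        by (auto simp: inj_on_def)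
      then show "open (chart_map M i ` (S \<inter> T \<inter> chart_dom M i))"
        using S T i by (simp add: manifold_open_def open_Int)
    qed
  next
    fix K assume K: "\<forall>W\<in>K. manifold_open M W"
    show "manifold_open M (\<Union>K)"
      unfolding manifold_open_def
    proof (intro conjI ballI)
      show "\<Union>K \<subseteq> points M" using K by (auto simp: manifold_open_def)
      fix i assume i: "i \<in> charts M"
      have "chart_map M i ` (\<Union>K \<inter> chart_dom M i) =
          (\<Union>W\<in>K. chart_map M i ` (W \<inter> chart_dom M i))"
        by auto
      then show "open (chart_map M i ` (\<Union>K \<inter> chart_dom M i))"
        using K i by (auto simp: manifold_open_def)
    qed
  qed
  then show ?thesis
    by (simp add: manifold_topology_def topology_inverse')
qed

definition riemannian_manifold :: "('i, 'a, 'n::finite) riemannian \<Rightarrow> bool" where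
  "riemannian_manifold M \<longleftrightarrow>
     smooth_atlas M \<and>
     Hausdorff_space (manifold_topology M) \<and>
     second_countable (manifold_topology M) \<and>
     (\<forall>i\<in>charts M.
        smooth_on (chart_map M i ` chart_dom M i) (metric M i) \<and>
        (\<forall>x\<in>chart_map M i ` chart_dom M i.
           transpose (metric M i x) = metric M i x \<and>
           (\<forall>v. v \<noteq> 0 \<longrightarrow> metric_form (metric M i x) v v > 0))) \<and>
     (\<forall>i\<in>charts M. \<forall>j\<in>charts M. \<forall>q\<in>chart_dom M i \<inter> chart_dom M j. \<forall>v w.
        metric_form (metric M i (chart_map M i q)) v w =
        metric_form (metric M j (chart_map M j q))
          (frechet_derivative (transition M i j) (at (chart_map M i q)) v)
          (frechet_derivative (transition M i j) (at (chart_map M i q)) w))"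

text \<open>A tangent vector at \<open>q\<close> is the family of its components in the charts around \<open>q\<close>; the
  components in the other charts are set to \<open>0\<close>, so that equal vectors are equal families.\<close>

definition tangent_space :: "('i, 'a, 'n::finite) riemannian \<Rightarrow> 'a \<Rightarrow> ('i \<Rightarrow> real^'n) set" where
  "tangent_space M q = {\<xi>.
     (\<forall>i. i \<in> charts M \<and> q \<in> chart_dom M i \<or> \<xi> i = 0) \<and>
     (\<forall>i\<in>charts M. \<forall>j\<in>charts M. q \<in> chart_dom M i \<inter> chart_dom M j \<longrightarrow>
        \<xi> j = frechet_derivative (transition M i j) (at (chart_map M i q)) (\<xi> i))}"


section \<open>The tangent bundle with the Sasaki metric\<close>

text \<open>In induced coordinates, \<open>Inl k\<close> indexes \<open>x\<^sup>k\<close> and \<open>Inr k\<close> indexes \<open>\<xi>\<^sup>k\<close>.\<close>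

definition base_part :: "real^('n + 'n) \<Rightarrow> real^'n::finite" where
  "base_part z = (\<chi> k. z $ Inl k)"

definition fibre_part :: "real^('n + 'n) \<Rightarrow> real^'n::finite" where
  "fibre_part z = (\<chi> k. z $ Inr k)"

definition join :: "real^'n \<Rightarrow> real^'n \<Rightarrow> real^('n + 'n::finite)" where
  "join x \<xi> = (\<chi> a. case a of Inl k \<Rightarrow> x $ k | Inr k \<Rightarrow> \<xi> $ k)"

definition connection_map ::
    "('i, 'a, 'n::finite) riemannian \<Rightarrow> 'i \<Rightarrow> real^('n + 'n) \<Rightarrow> real^('n + 'n) \<Rightarrow> real^'n" where
  "connection_map M i z X =
     fibre_part X + christoffel_map (metric M i) (base_part z) (fibre_part z) (base_part X)"

definition sasaki_form ::
    "('i, 'a, 'n::finite) riemannian \<Rightarrow> 'i \<Rightarrow> real^('n + 'n) \<Rightarrow> real^('n + 'n) \<Rightarrow> real^('n + 'n) \<Rightarrow> real" where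
  "sasaki_form M i z X Y =
     metric_form (metric M i (base_part z)) (base_part X) (base_part Y) +
     metric_form (metric M i (base_part z)) (connection_map M i z X) (connection_map M i z Y)"

definition tangent_bundle ::
    "('i, 'a, 'n::finite) riemannian \<Rightarrow> ('i, 'a \<times> ('i \<Rightarrow> real^'n), 'n + 'n) riemannian" where
  "tangent_bundle M =
     \<lparr> charts = charts M,
       chart_dom = (\<lambda>i. {(q, \<xi>). q \<in> chart_dom M i \<and> \<xi> \<in> tangent_space M q}),
       chart_map = (\<lambda>i (q, \<xi>). join (chart_map M i q) (\<xi> i)),
       metric = (\<lambda>i z. \<chi> a b. sasaki_form M i z (axis a 1) (axis b 1)) \<rparr>"


section \<open>Maps into a Riemannian manifold\<close>

text \<open>Curves and surfaces are maps from an open set of parameters; vector fields along them are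
  represented, in a given chart, by their components.\<close>

definition smooth_map ::
    "('i, 'a, 'n::finite) riemannian \<Rightarrow> 'p::euclidean_space set \<Rightarrow> ('p \<Rightarrow> 'a) \<Rightarrow> bool" where
  "smooth_map M D F \<longleftrightarrow>
     F ` D \<subseteq> points M \<and>
     (\<forall>i\<in>charts M. open {u\<in>D. F u \<in> chart_dom M i} \<and>
        smooth_on {u\<in>D. F u \<in> chart_dom M i} (chart_map M i \<circ> F))"

definition tangent_map ::
    "('i, 'a, 'n::finite) riemannian \<Rightarrow> 'i \<Rightarrow> ('p::euclidean_space \<Rightarrow> 'a) \<Rightarrow> 'p \<Rightarrow> 'p \<Rightarrow> real^'n" where
  "tangent_map M i F u v = frechet_derivative (chart_map M i \<circ> F) (at u) v"

text \<open>The covariant derivative at \<open>u\<close>, in the parameter direction \<open>v\<close>, of the vector field along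
  \<open>F\<close> with components \<open>V\<close> in chart \<open>i\<close>.\<close>

definition cov_deriv ::
    "('i, 'a, 'n::finite) riemannian \<Rightarrow> 'i \<Rightarrow> ('p::euclidean_space \<Rightarrow> 'a) \<Rightarrow> ('p \<Rightarrow> real^'n) \<Rightarrow> 'p \<Rightarrow> 'p \<Rightarrow> real^'n" where
  "cov_deriv M i F V u v =
     frechet_derivative V (at u) v +
     christoffel_map (metric M i) (chart_map M i (F u)) (tangent_map M i F u v) (V u)"

definition geodesic :: "('i, 'a, 'n::finite) riemannian \<Rightarrow> real set \<Rightarrow> (real \<Rightarrow> 'a) \<Rightarrow> bool" where
  "geodesic M D \<gamma> \<longleftrightarrow>
     smooth_map M D \<gamma> \<and>
     (\<forall>i\<in>charts M. \<forall>s\<in>D. \<gamma> s \<in> chart_dom M i \<longrightarrow>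
        cov_deriv M i \<gamma> (\<lambda>r. tangent_map M i \<gamma> r 1) s 1 = 0)"

definition vector_field_along ::
    "('i, 'a, 'n::finite) riemannian \<Rightarrow> real set \<Rightarrow> (real \<Rightarrow> 'a) \<Rightarrow> (real \<Rightarrow> 'i \<Rightarrow> real^'n) \<Rightarrow> bool" where
  "vector_field_along M D \<gamma> e \<longleftrightarrow>
     (\<forall>s\<in>D. e s \<in> tangent_space M (\<gamma> s)) \<and>
     (\<forall>i\<in>charts M. smooth_on {s\<in>D. \<gamma> s \<in> chart_dom M i} (\<lambda>s. e s i))"

definition unit_along ::
    "('i, 'a, 'n::finite) riemannian \<Rightarrow> real set \<Rightarrow> (real \<Rightarrow> 'a) \<Rightarrow> (real \<Rightarrow> 'i \<Rightarrow> real^'n) \<Rightarrow> bool" where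
  "unit_along M D \<gamma> e \<longleftrightarrow>
     (\<forall>i\<in>charts M. \<forall>s\<in>D. \<gamma> s \<in> chart_dom M i \<longrightarrow>
        metric_form (metric M i (chart_map M i (\<gamma> s))) (e s i) (e s i) = 1)"

definition parallel_along ::
    "('i, 'a, 'n::finite) riemannian \<Rightarrow> real set \<Rightarrow> (real \<Rightarrow> 'a) \<Rightarrow> (real \<Rightarrow> 'i \<Rightarrow> real^'n) \<Rightarrow> bool" where
  "parallel_along M D \<gamma> e \<longleftrightarrow>
     (\<forall>i\<in>charts M. \<forall>s\<in>D. \<gamma> s \<in> chart_dom M i \<longrightarrow> cov_deriv M i \<gamma> (\<lambda>r. e r i) s 1 = 0)"


section \<open>Surfaces\<close>

definition regular_points ::
    "('i, 'a, 'n::finite) riemannian \<Rightarrow> (real^2) set \<Rightarrow> (real^2 \<Rightarrow> 'a) \<Rightarrow> (real^2) set" where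
  "regular_points M D F =
     {u\<in>D. \<forall>i\<in>charts M. F u \<in> chart_dom M i \<longrightarrow> inj (tangent_map M i F u)}"

definition induced_metric ::
    "('i, 'a, 'n::finite) riemannian \<Rightarrow> 'i \<Rightarrow> (real^2 \<Rightarrow> 'a) \<Rightarrow> real^2 \<Rightarrow> real^2^2" where
  "induced_metric M i F u =
     (\<chi> a b. metric_form (metric M i (chart_map M i (F u)))
        (tangent_map M i F u (axis a 1)) (tangent_map M i F u (axis b 1)))"

text \<open>The second fundamental form with respect to a normal vector \<open>\<nu>\<close>, with the second argument
  extended to the coordinate field with constant coefficients \<open>w\<close>.\<close>

definition second_fundamental_form ::
    "('i, 'a, 'n::finite) riemannian \<Rightarrow> 'i \<Rightarrow> (real^2 \<Rightarrow> 'a) \<Rightarrow> real^2 \<Rightarrow> real^'n \<Rightarrow> real^2 \<Rightarrow> real^2 \<Rightarrow> real" where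
  "second_fundamental_form M i F u \<nu> v w =
     metric_form (metric M i (chart_map M i (F u)))
       (cov_deriv M i F (\<lambda>r. tangent_map M i F r w) u v) \<nu>"

definition normal_space ::
    "('i, 'a, 'n::finite) riemannian \<Rightarrow> 'i \<Rightarrow> (real^2 \<Rightarrow> 'a) \<Rightarrow> real^2 \<Rightarrow> (real^'n) set" where
  "normal_space M i F u =
     {\<nu>. \<forall>v. metric_form (metric M i (chart_map M i (F u))) (tangent_map M i F u v) \<nu> = 0}"

text \<open>Both properties concern the surface where its parametrization is regular; elsewhere there
  is no tangent plane and the induced metric degenerates.\<close>

definition totally_geodesic_surface ::
    "('i, 'a, 'n::finite) riemannian \<Rightarrow> (real^2) set \<Rightarrow> (real^2 \<Rightarrow> 'a) \<Rightarrow> bool" where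
  "totally_geodesic_surface M D F \<longleftrightarrow>
     smooth_map M D F \<and>
     (\<forall>u\<in>regular_points M D F. \<forall>i\<in>charts M. F u \<in> chart_dom M i \<longrightarrow>
        (\<forall>\<nu>\<in>normal_space M i F u. \<forall>v w. second_fundamental_form M i F u \<nu> v w = 0))"

definition intrinsically_flat_surface ::
    "('i, 'a, 'n::finite) riemannian \<Rightarrow> (real^2) set \<Rightarrow> (real^2 \<Rightarrow> 'a) \<Rightarrow> bool" where
  "intrinsically_flat_surface M D F \<longleftrightarrow>
     smooth_map M D F \<and>
     (\<forall>u\<in>regular_points M D F. \<forall>i\<in>charts M. F u \<in> chart_dom M i \<longrightarrow>
        gaussian_curvature (induced_metric M i F) u = 0)"

text \<open>The parameters are \<open>s = u $ 1\<close> and \<open>t = u $ 2\<close>.\<close>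

definition cylinder ::
    "(real \<Rightarrow> 'a) \<Rightarrow> (real \<Rightarrow> real) \<Rightarrow> (real \<Rightarrow> 'i \<Rightarrow> real^'n) \<Rightarrow> real^2 \<Rightarrow> 'a \<times> ('i \<Rightarrow> real^'n)" where
  "cylinder \<gamma> \<rho> e u = (\<gamma> (u $ 1), \<lambda>i. (u $ 2 * \<rho> (u $ 1)) *\<^sub>R e (u $ 1) i)"

end

theory Submission
  imports Defs
begin

text \<open>
  A tangent vector \<open>X\<close> of \<open>TM\<close> splits into its horizontal part \<open>\<pi>\<^sub>*X\<close> and its vertical part \<open>KX\<close>,
  which are orthogonal for the Sasaki metric. Along the cylinder \<open>P(s, t) = (\<gamma>(s), t \<rho>(s) e(s))\<close>,
  parallelism of \<open>e\<close> gives \<open>K \<partial>\<^sub>s P = t \<rho>' e\<close> and \<open>K \<partial>\<^sub>t P = \<rho> e\<close>, so the fibre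
  coordinate and all vertical parts are multiples of the single vector \<open>e\<close>.

  The Levi-Civita connection of the Sasaki metric differs from the horizontal and vertical lifts of
  that of \<open>M\<close> by curvature terms. On the cylinder these are of the form \<open>\<langle>R(\<gamma>', n)e, e\<rangle>\<close> and vanish
  (\<open>curvature_skew\<close>). What remains of the second derivatives of \<open>P\<close> is \<open>\<nabla>\<^sub>\<gamma>\<^sub>' \<gamma>' = 0\<close> and
  the second derivative of \<open>t \<rho>(s)\<close> times the vertical lift of \<open>e\<close> (\<open>cov_deriv_P\<close>). Where \<open>P\<close> is
  regular, \<open>\<rho>\<close> is nonzero and that lift is \<open>\<partial>\<^sub>t P / \<rho>\<close>, which is tangent to the surface: the second
  fundamental form vanishes.

  Since \<open>e\<close> has length one, the induced metric is \<open>|\<gamma>'|\<^sup>2 ds\<^sup>2 + dy\<^sup>2\<close> with \<open>y = t \<rho>(s)\<close>. In the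
  coordinates \<open>s\<close>, \<open>t\<close> it has \<open>\<Gamma>\<^sup>l\<^sub>2\<^sub>2 = 0\<close>, \<open>\<Gamma>\<^sup>1\<^sub>1\<^sub>2 = 0\<close> and
  \<open>\<Gamma>\<^sup>2\<^sub>1\<^sub>2 = \<rho>'/\<rho>\<close>, a function of \<open>s\<close> alone (\<open>christoffel_first_form\<close>), and every term
  of the Gaussian curvature is then zero.

  All covariant derivatives are tested against a vector, which lowers the index of the Christoffel
  symbols (\<open>metric_form_christoffel_map\<close>). Only derivatives of the metric along fixed vectors are
  left, and the inverse of the Sasaki matrix never has to be computed.
\<close>

section \<open>Calculus of $C^k$ maps\<close>

lemma Ck_on_cong:
  assumes "open S" "\<And>x. x \<in> S \<Longrightarrow> f x = g x" "Ck_on k S f"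
  shows "Ck_on k S g"
  using assms(2,3)
proof (induction k arbitrary: f g)
  case 0
  then show ?case using continuous_on_cong[of S S f g] by simp
next
  case (Suc k)
  have d: "(g has_derivative frechet_derivative f (at x)) (at x)" if "x \<in> S" for x
  proof (rule has_derivative_transform_within_open[OF _ assms(1) that Suc.prems(1)])
    show "(f has_derivative frechet_derivative f (at x)) (at x)"
      using Suc.prems(2) that by (simp add: frechet_derivative_works[symmetric])
  qed
  have eq: "frechet_derivative f (at x) v = frechet_derivative g (at x) v" if "x \<in> S" for x v
    using frechet_derivative_at[OF d[OF that]] by (rule fun_cong)
  have "Ck_on k S (\<lambda>x. frechet_derivative g (at x) v)" for v
  proof (rule Suc.IH)
    show "frechet_derivative f (at x) v = frechet_derivative g (at x) v" if "x \<in> S" for x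
      by (rule eq[OF that])
    show "Ck_on k S (\<lambda>x. frechet_derivative f (at x) v)"
      using Suc.prems(2) by simp
  qed
  moreover have "g differentiable (at x)" if "x \<in> S" for x
    using d[OF that] unfolding differentiable_def by blast
  ultimately show ?case by simp
qed

lemma Ck_on_Suc_imp_Ck_on: "Ck_on (Suc k) S f \<Longrightarrow> Ck_on k S f"
proof (induction k arbitrary: f)
  case 0
  then show ?case
    by (auto intro!: continuous_at_imp_continuous_on differentiable_imp_continuous_within)
next
  case (Suc k)
  have "Ck_on k S (\<lambda>x. frechet_derivative f (at x) v)" for v
    using Suc.prems by (intro Suc.IH) simp
  then show ?case using Suc.prems by simp
qed

lemma Ck_on_subset: "Ck_on k S f \<Longrightarrow> T \<subseteq> S \<Longrightarrow> Ck_on k T f"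
  by (induction k arbitrary: f) (auto intro: continuous_on_subset)

text \<open>With a guessed derivative \<open>f'\<close> the rules of differentiation prove smoothness by induction on
  the order, without any computation with \<open>frechet_derivative\<close>.\<close>

lemma Ck_on_SucI:
  assumes "open S" "\<And>x. x \<in> S \<Longrightarrow> (f has_derivative f' x) (at x)"
    and "\<And>v. Ck_on k S (\<lambda>x. f' x v)"
  shows "Ck_on (Suc k) S f"
proof -
  have eq: "f' x v = frechet_derivative f (at x) v" if "x \<in> S" for x v
    using frechet_derivative_at[OF assms(2)[OF that]] by (rule fun_cong)
  have "Ck_on k S (\<lambda>x. frechet_derivative f (at x) v)" for v
    by (rule Ck_on_cong[OF assms(1) _ assms(3)[of v]]) (rule eq)
  moreover have "f differentiable (at x)" if "x \<in> S" for x
    using assms(2)[OF that] unfolding differentiable_def by blast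
  ultimately show ?thesis by simp
qed

lemma Ck_on_add:
  assumes "open S" "Ck_on k S f" "Ck_on k S g"
  shows "Ck_on k S (\<lambda>x. f x + g x)"
  using assms(2,3)
proof (induction k arbitrary: f g)
  case 0
  then show ?case by (simp add: continuous_on_add)
next
  case (Suc k)
  have d: "(f has_derivative frechet_derivative f (at x)) (at x)"
    "(g has_derivative frechet_derivative g (at x)) (at x)" if "x \<in> S" for x
    using Suc.prems that by (simp_all add: frechet_derivative_works[symmetric])
  have "Ck_on k S (\<lambda>x. frechet_derivative f (at x) v)" "Ck_on k S (\<lambda>x. frechet_derivative g (at x) v)" for v
    using Suc.prems by simp_all
  from Ck_on_SucI[OF assms(1) has_derivative_add[OF d] Suc.IH[OF this]] show ?case .
qed

lemma (in bounded_bilinear) Ck_on: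
  assumes "open S" "Ck_on k S f" "Ck_on k S g"
  shows "Ck_on k S (\<lambda>x. prod (f x) (g x))"
  using assms(2,3)
proof (induction k arbitrary: f g)
  case 0
  then show ?case by (simp add: continuous_on)
next
  case (Suc k)
  note lower = Suc.prems[THEN Ck_on_Suc_imp_Ck_on]
  have d: "(f has_derivative frechet_derivative f (at x)) (at x)"
    "(g has_derivative frechet_derivative g (at x)) (at x)" if "x \<in> S" for x
    using Suc.prems that by (simp_all add: frechet_derivative_works[symmetric])
  have c: "Ck_on k S (\<lambda>x. frechet_derivative f (at x) v)" "Ck_on k S (\<lambda>x. frechet_derivative g (at x) v)" for v
    using Suc.prems by simp_all
  show ?case
    by (rule Ck_on_SucI[OF assms(1) FDERIV[OF d]])
      (assumption, assumption, intro Ck_on_add[OF assms(1)] Suc.IH lower c)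
qed

lemma Ck_on_const: "Ck_on k S (\<lambda>x. c)"
  by (induction k arbitrary: c) simp_all

lemma (in bounded_linear) Ck_on:
  assumes "open S" "Ck_on k S g"
  shows "Ck_on k S (\<lambda>x. f (g x))"
  using assms(2)
proof (induction k arbitrary: g)
  case 0
  then show ?case by (simp add: continuous_on)
next
  case (Suc k)
  have d: "(g has_derivative frechet_derivative g (at x)) (at x)" if "x \<in> S" for x
    using Suc.prems that by (simp add: frechet_derivative_works[symmetric])
  have "Ck_on k S (\<lambda>x. frechet_derivative g (at x) v)" for v
    using Suc.prems by simp
  from Ck_on_SucI[OF assms(1) has_derivative[OF d] Suc.IH[OF this]] show ?case .
qed

lemma Ck_on_bounded_linear:
  assumes "open S" "bounded_linear f"
  shows "Ck_on k S f"
proof (cases k)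
  case 0
  then show ?thesis using linear_continuous_on[OF assms(2)] by simp
next
  case (Suc m)
  then show ?thesis
    by (simp only:) (rule Ck_on_SucI[OF assms(1) bounded_linear_imp_has_derivative[OF assms(2)]],
      rule Ck_on_const)
qed

lemma Ck_on_compose_linear:
  fixes L :: "'p::euclidean_space \<Rightarrow> 'q::euclidean_space"
  assumes "open S" "bounded_linear L" "Ck_on k S f"
  shows "Ck_on k (L -` S) (\<lambda>u. f (L u))"
  using assms(3)
proof (induction k arbitrary: f)
  case 0
  then have "continuous_on S f" by simp
  from continuous_on_compose2[OF this linear_continuous_on[OF assms(2)], of "L -` S"]
  show ?case by auto
next
  case (Suc k)
  have o: "open (L -` S)"
    using assms(1,2) by (intro continuous_open_vimage linear_continuous_at)
  have d: "((\<lambda>u. f (L u)) has_derivative (\<lambda>v. frechet_derivative f (at (L u)) (L v))) (at u)"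
    if "u \<in> L -` S" for u
    using Suc.prems that
    by (intro has_derivative_compose[OF bounded_linear_imp_has_derivative[OF assms(2)]])
      (simp add: frechet_derivative_works[symmetric])
  have "Ck_on k S (\<lambda>x. frechet_derivative f (at x) (L v))" for v
    using Suc.prems by simp
  from Ck_on_SucI[OF o d Suc.IH[OF this]] show ?case .
qed

text \<open>The second difference of \<open>f\<close> over the parallelogram spanned by \<open>s v\<close> and \<open>s w\<close> is
  symmetric in \<open>v\<close> and \<open>w\<close>; two applications of the mean value theorem show that, divided
  by \<open>s\<^sup>2\<close>, it tends to the iterated derivative, so the latter is symmetric as well.\<close>

lemma second_difference_tendsto:
  fixes f :: "'p::euclidean_space \<Rightarrow> real"
  assumes U: "open U" "x \<in> U" and f: "Ck_on 2 U f"
  shows "((\<lambda>s. (f (x + s *\<^sub>R v + s *\<^sub>R w) - f (x + s *\<^sub>R v) - f (x + s *\<^sub>R w) + f x) / s\<^sup>2)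
     \<longlongrightarrow> frechet_derivative (\<lambda>y. frechet_derivative f (at y) v) (at x) w) (at_right 0)"
proof -
  define fv where "fv y = frechet_derivative f (at y) v" for y
  define H where "H y = frechet_derivative fv (at y) w" for y
  have f1: "(f has_derivative frechet_derivative f (at y)) (at y)"
    and fv: "(fv has_derivative frechet_derivative fv (at y)) (at y)" if "y \<in> U" for y
    using f that unfolding numeral_2_eq_2 fv_def[abs_def] Ck_on.simps
    by (simp_all only: frechet_derivative_works[symmetric])
  have "continuous_on U H"
    using f unfolding numeral_2_eq_2 Ck_on.simps H_def[abs_def] fv_def[abs_def] by blast
  then have H: "isCont H x" using U by (simp add: continuous_on_eq_continuous_at)
  obtain d where d: "d > 0" "ball x d \<subseteq> U" using U by (rule openE)
  (* the summand 1 only makes K positive; all points occurring below lie in the ball of radius s * K *)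
  define K where "K = norm v + norm w + 1"
  have K: "K > 0" unfolding K_def by (intro add_nonneg_pos) simp_all
  have in_ball: "x + r *\<^sub>R v + q *\<^sub>R w \<in> ball x (s * K)"
    if "0 \<le> r" "r \<le> s" "0 \<le> q" "q \<le> s" "0 < s" for r q s
  proof -
    have "norm (r *\<^sub>R v + q *\<^sub>R w) \<le> r * norm v + q * norm w"
      using that by (intro norm_triangle_le) auto
    also have "\<dots> \<le> s * norm v + s * norm w"
      using that by (intro add_mono mult_right_mono) auto
    also have "\<dots> < s * K" using that by (simp add: K_def algebra_simps)
    finally have "norm (- (r *\<^sub>R v + q *\<^sub>R w)) < s * K" unfolding norm_minus_cancel .
    moreover have "x - (x + r *\<^sub>R v + q *\<^sub>R w) = - (r *\<^sub>R v + q *\<^sub>R w)" by simp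
    ultimately show ?thesis by (simp only: mem_ball dist_norm)
  qed
  have mvt: "\<exists>y \<in> ball x (s * K).
      (f (x + s *\<^sub>R v + s *\<^sub>R w) - f (x + s *\<^sub>R v) - f (x + s *\<^sub>R w) + f x) / s\<^sup>2 = H y"
    if s: "0 < s" "s * K < d" for s
  proof -
    have inU: "x + r *\<^sub>R v + q *\<^sub>R w \<in> U" if "0 \<le> r" "r \<le> s" "0 \<le> q" "q \<le> s" for r q
      using in_ball[OF that s(1)] s d by auto
    have inU': "x + r *\<^sub>R v \<in> U" if "0 \<le> r" "r \<le> s" for r
      using inU[of r 0] that s by simp
    define \<phi> where "\<phi> r = f (x + r *\<^sub>R v + s *\<^sub>R w) - f (x + r *\<^sub>R v)" for r
    have \<phi>': "(\<phi> has_real_derivative fv (x + r *\<^sub>R v + s *\<^sub>R w) - fv (x + r *\<^sub>R v)) (at r)"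
      if "0 \<le> r" "r \<le> s" for r
    proof -
      have "((\<lambda>r. x + r *\<^sub>R v + s *\<^sub>R w) has_derivative (\<lambda>h. h *\<^sub>R v)) (at r)"
        "((\<lambda>r. x + r *\<^sub>R v) has_derivative (\<lambda>h. h *\<^sub>R v)) (at r)"
        by (auto intro!: derivative_eq_intros)
      from has_derivative_compose[OF this(1) f1] has_derivative_compose[OF this(2) f1]
      have \<phi>: "(\<phi> has_derivative (\<lambda>h. frechet_derivative f (at (x + r *\<^sub>R v + s *\<^sub>R w)) (h *\<^sub>R v)
          - frechet_derivative f (at (x + r *\<^sub>R v)) (h *\<^sub>R v))) (at r)"
        unfolding \<phi>_def[abs_def] using inU[of r s] inU'[of r] that s
        by (intro has_derivative_diff) auto
      have "linear (frechet_derivative f (at (x + r *\<^sub>R v + s *\<^sub>R w)))"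
        "linear (frechet_derivative f (at (x + r *\<^sub>R v)))"
        using inU[of r s] inU'[of r] that s by (auto intro!: has_derivative_linear[OF f1])
      from this[THEN linear_scale] show ?thesis
        by (intro has_derivative_imp_has_field_derivative[OF \<phi>]) (simp add: fv_def right_diff_distrib)
    qed
    obtain r where r: "0 < r" "r < s"
      "\<phi> s - \<phi> 0 = (s - 0) * (fv (x + r *\<^sub>R v + s *\<^sub>R w) - fv (x + r *\<^sub>R v))"
      using MVT2[OF s(1) \<phi>'] by blast
    define \<psi> where "\<psi> q = fv (x + r *\<^sub>R v + q *\<^sub>R w)" for q
    have \<psi>': "(\<psi> has_real_derivative H (x + r *\<^sub>R v + q *\<^sub>R w)) (at q)" if "0 \<le> q" "q \<le> s" for q
    proof -
      have "((\<lambda>q. x + r *\<^sub>R v + q *\<^sub>R w) has_derivative (\<lambda>h. h *\<^sub>R w)) (at q)"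
        by (auto intro!: derivative_eq_intros)
      from has_derivative_compose[OF this fv]
      have \<psi>: "(\<psi> has_derivative (\<lambda>h. frechet_derivative fv (at (x + r *\<^sub>R v + q *\<^sub>R w)) (h *\<^sub>R w))) (at q)"
        unfolding \<psi>_def[abs_def] using inU[of r q] that r by auto
      have "linear (frechet_derivative fv (at (x + r *\<^sub>R v + q *\<^sub>R w)))"
        using inU[of r q] that r by (auto intro!: has_derivative_linear[OF fv])
      from linear_scale[OF this] show ?thesis
        by (intro has_derivative_imp_has_field_derivative[OF \<psi>]) (simp add: H_def)
    qed
    obtain q where q: "0 < q" "q < s" "\<psi> s - \<psi> 0 = (s - 0) * H (x + r *\<^sub>R v + q *\<^sub>R w)"
      using MVT2[OF s(1) \<psi>'] by blast
    have "x + r *\<^sub>R v + q *\<^sub>R w \<in> ball x (s * K)" using in_ball r q s by simp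
    moreover have "\<phi> s - \<phi> 0 = s\<^sup>2 * H (x + r *\<^sub>R v + q *\<^sub>R w)"
      using r(3) q(3) by (simp add: \<psi>_def power2_eq_square)
    ultimately show ?thesis
      using s by (intro bexI[of _ "x + r *\<^sub>R v + q *\<^sub>R w"]) (auto simp: \<phi>_def field_simps)
  qed
  show ?thesis
    unfolding fv_def[abs_def, symmetric] H_def[symmetric]
  proof (rule tendstoI)
    fix \<epsilon> :: real assume "\<epsilon> > 0"
    then obtain \<delta> where \<delta>: "\<delta> > 0" "\<And>y. dist y x < \<delta> \<Longrightarrow> dist (H y) (H x) < \<epsilon>"
      using H unfolding continuous_at_eps_delta by blast
    have "\<forall>\<^sub>F s in at_right 0. 0 < s \<and> s < min (d / K) (\<delta> / K)"
      unfolding eventually_at_right_field using d K \<delta>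
      by (intro exI[of _ "min (d / K) (\<delta> / K)"]) simp
    then show "\<forall>\<^sub>F s in at_right 0. dist ((f (x + s *\<^sub>R v + s *\<^sub>R w) - f (x + s *\<^sub>R v)
        - f (x + s *\<^sub>R w) + f x) / s\<^sup>2) (H x) < \<epsilon>"
    proof eventually_elim
      case (elim s)
      then have s: "0 < s" "s * K < d" "s * K < \<delta>" using K by (auto simp: pos_less_divide_eq)
      obtain y where y: "y \<in> ball x (s * K)"
        "(f (x + s *\<^sub>R v + s *\<^sub>R w) - f (x + s *\<^sub>R v) - f (x + s *\<^sub>R w) + f x) / s\<^sup>2 = H y"
        using mvt[OF s(1,2)] by blast
      then have "dist y x < \<delta>" using s(3) by (simp add: dist_commute)
      then show ?case unfolding y(2) by (rule \<delta>(2))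
    qed
  qed
qed

lemma iterated_derivative_symmetric:
  fixes f :: "'p::euclidean_space \<Rightarrow> real"
  assumes "open U" "x \<in> U" "Ck_on 2 U f"
  shows "frechet_derivative (\<lambda>y. frechet_derivative f (at y) v) (at x) w
    = frechet_derivative (\<lambda>y. frechet_derivative f (at y) w) (at x) v"
proof -
  let ?\<Delta> = "\<lambda>v w s. (f (x + s *\<^sub>R v + s *\<^sub>R w) - f (x + s *\<^sub>R v) - f (x + s *\<^sub>R w) + f x) / s\<^sup>2"
  have "?\<Delta> w v = ?\<Delta> v w"
    by (rule ext) (simp add: add.commute add.left_commute)
  then have "(?\<Delta> v w \<longlongrightarrow> frechet_derivative (\<lambda>y. frechet_derivative f (at y) w) (at x) v) (at_right 0)"
    using second_difference_tendsto[OF assms, of w v] by (simp only:)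
  from tendsto_unique[OF trivial_limit_at_right_real second_difference_tendsto[OF assms, of v w] this]
  show ?thesis .
qed

section \<open>A metric in a coordinate domain\<close>

lemma metric_form_add:
  "metric_form (A + B) v w = metric_form A v w + metric_form B v w"
  "metric_form A (v + v') w = metric_form A v w + metric_form A v' w"
  "metric_form A v (w + w') = metric_form A v w + metric_form A v w'"
  by (simp_all add: metric_form_def matrix_vector_mult_add_rdistrib matrix_vector_right_distrib
      inner_add_left inner_add_right)

lemma metric_form_scaleR:
  "metric_form (c *\<^sub>R A) v w = c * metric_form A v w"
  "metric_form A (c *\<^sub>R v) w = c * metric_form A v w"
  "metric_form A v (c *\<^sub>R w) = c * metric_form A v w"
  by (simp_all add: metric_form_def scaleR_matrix_vector_assoc [symmetric] matrix_vector_mult_scaleR)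

lemma metric_form_zero [simp]:
  "metric_form 0 v w = 0" "metric_form A 0 w = 0" "metric_form A v 0 = 0"
  by (simp_all add: metric_form_def)

lemma metric_form_minus:
  "metric_form A (- v) w = - metric_form A v w"
  "metric_form A v (- w) = - metric_form A v w"
  using metric_form_scaleR(2)[of A "-1" v w] metric_form_scaleR(3)[of A v "-1" w] by simp_all

lemma metric_form_diff:
  "metric_form A (v - v') w = metric_form A v w - metric_form A v' w"
  by (simp add: metric_form_def inner_diff_left)

lemmas metric_form_linear = metric_form_add metric_form_scaleR metric_form_minus metric_form_diff

lemma metric_form_sum_entries: "metric_form A v w = (\<Sum>i\<in>UNIV. \<Sum>j\<in>UNIV. v $ i * w $ j * A $ i $ j)"
  by (simp add: metric_form_def inner_vec_def matrix_vector_mult_def sum_distrib_left mult_ac)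

lemma metric_form_axis: "metric_form A (axis i 1) (axis j 1) = A $ i $ j"
  by (simp add: metric_form_def inner_axis' matrix_vector_mult_basis column_def)

lemma metric_form_commute: "transpose A = A \<Longrightarrow> metric_form A v w = metric_form A w v"
  unfolding metric_form_def
  by (metis dot_lmul_matrix inner_commute transpose_matrix_vector)

lemma invertible_if_positive_definite:
  assumes "\<And>v. v \<noteq> 0 \<Longrightarrow> metric_form A v v > 0"
  shows "invertible A"
proof -
  have "v = 0" if "A *v v = 0" for v
    using assms[of v] that by (auto simp: metric_form_def)
  then show ?thesis
    using invertible_left_inverse matrix_left_invertible_ker by blast
qed

lemma positive_definite_nondegenerate:
  assumes pos: "\<And>v. v \<noteq> 0 \<Longrightarrow> metric_form A v v > 0"
    and eq: "\<And>u. metric_form A v u = metric_form A w u"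
  shows "v = w"
proof (rule ccontr)
  assume "v \<noteq> w"
  then have "metric_form A (v - w) (v - w) > 0" by (intro pos) simp
  then show False using eq by (simp add: metric_form_diff)
qed

lemma bounded_linear_metric_form: "bounded_linear (\<lambda>A. metric_form A v w)"
  unfolding linear_conv_bounded_linear[symmetric] by (intro linearI) (simp_all add: metric_form_linear)

lemma has_derivative_metric_form:
  assumes "(A has_derivative A') (at p)" "(V has_derivative V') (at p)" "(W has_derivative W') (at p)"
  shows "((\<lambda>p. metric_form (A p) (V p) (W p)) has_derivative
    (\<lambda>h. metric_form (A' h) (V p) (W p) + metric_form (A p) (V' h) (W p)
       + metric_form (A p) (V p) (W' h))) (at p)"
proof -
  have "bounded_bilinear (\<lambda>(A::real^'n^'m) x. A *v x)"
    by (intro bilinear_conv_bounded_bilinear[THEN iffD1])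
      (auto simp: bilinear_def matrix_vector_mult_add_rdistrib scaleR_matrix_vector_assoc
        matrix_vector_right_distrib matrix_vector_mult_scaleR intro!: linearI)
  from has_derivative_inner[OF assms(2) bounded_bilinear.FDERIV[OF this assms(1,3)]]
  show ?thesis by (simp add: metric_form_def inner_add_right add_ac)
qed

lemma has_derivative_vec:
  fixes f :: "'p::real_normed_vector \<Rightarrow> 'b::euclidean_space^'n"
  assumes "\<And>k. ((\<lambda>x. f x $ k) has_derivative (\<lambda>h. f' h $ k)) (at p)"
  shows "(f has_derivative f') (at p)"
  unfolding has_derivative_componentwise_within[of f f']
proof
  fix b :: "'b^'n" assume "b \<in> Basis"
  then obtain k u where b: "b = axis k u" by (auto simp: Basis_vec_def)
  show "((\<lambda>x. f x \<bullet> b) has_derivative (\<lambda>x. f' x \<bullet> b)) (at p)"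
    unfolding b inner_axis by (intro has_derivative_inner_left assms)
qed

text \<open>The matrix entries are the values on basis vectors. For a metric given by a formula in the
  vectors, this yields the derivative of the matrix without computing its entries.\<close>

lemma has_derivative_metricE:
  fixes G :: "'p::real_normed_vector \<Rightarrow> real^'n^'n"
  assumes "\<And>v w. ((\<lambda>x. metric_form (G x) v w) has_derivative (\<lambda>a. B a v w)) (at p)"
  obtains G' where "(G has_derivative G') (at p)" "\<And>a v w. metric_form (G' a) v w = B a v w"
proof
  let ?G' = "\<lambda>a. \<chi> i j. B a (axis i 1) (axis j 1)"
  show G': "(G has_derivative ?G') (at p)"
  proof (intro has_derivative_vec)
    show "((\<lambda>x. G x $ i $ j) has_derivative (\<lambda>a. ?G' a $ i $ j)) (at p)" for i j
      using assms[of "axis i 1" "axis j 1"] by (simp add: metric_form_axis)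
  qed
  show "metric_form (?G' a) v w = B a v w" for a v w
    using has_derivative_unique[OF bounded_linear.has_derivative[OF bounded_linear_metric_form G'] assms]
    by (rule fun_cong)
qed

text \<open>By Cramer's rule the entries of the inverse are rational functions of the entries, which is
  what makes the Christoffel symbols differentiable.\<close>

lemma matrix_mul_matrix_inv: "invertible A \<Longrightarrow> A ** matrix_inv A = mat 1"
  unfolding invertible_def matrix_inv_def by (rule someI2_ex) auto

lemma matrix_inv_entry:
  fixes A :: "real^'n^'n"
  assumes "invertible A"
  shows "matrix_inv A $ k $ l = det (\<chi> i j. if j = k then axis l 1 $ i else A $ i $ j) / det A"
proof -
  have "A *v (matrix_inv A *v axis l 1) = axis l 1"
    using matrix_mul_matrix_inv[OF assms] by (simp add: matrix_vector_mul_assoc)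
  then have "matrix_inv A *v axis l 1 = (\<chi> k. det (\<chi> i j. if j = k then axis l 1 $ i else A $ i $ j) / det A)"
    by (simp only: cramer[OF assms[unfolded invertible_det_nz]])
  moreover have "(matrix_inv A *v axis l 1) $ k = matrix_inv A $ k $ l"
    by (simp add: matrix_vector_mult_basis column_def)
  ultimately show ?thesis by simp
qed

lemma differentiable_transform_open:
  assumes "open U" "p \<in> U" "\<And>x. x \<in> U \<Longrightarrow> f x = g x" "f differentiable (at p)"
  shows "g differentiable (at p)"
  using assms has_derivative_transform_within_open[of f _ p UNIV U g]
  unfolding differentiable_def by blast

lemma differentiable_det:
  fixes A :: "'p::real_normed_vector \<Rightarrow> real^'n^'n"
  assumes "\<And>i j. (\<lambda>x. A x $ i $ j) differentiable (at p)"
  shows "(\<lambda>x. det (A x)) differentiable (at p)"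
proof -
  have "(\<lambda>x. \<Prod>i\<in>UNIV. A x $ i $ \<sigma> i) differentiable (at p)" for \<sigma>
    using has_derivative_prod[of UNIV "\<lambda>i x. A x $ i $ \<sigma> i" "\<lambda>i. frechet_derivative (\<lambda>x. A x $ i $ \<sigma> i) (at p)" p UNIV]
      assms unfolding differentiable_def[of "\<lambda>x. \<Prod>i\<in>UNIV. A x $ i $ \<sigma> i"]
    by (auto simp: frechet_derivative_works)
  then show ?thesis
    unfolding det_def by (intro differentiable_sum differentiable_mult) auto
qed

lemma differentiable_matrix_inv_entry:
  fixes A :: "'p::real_normed_vector \<Rightarrow> real^'n^'n"
  assumes "open U" "p \<in> U" "\<And>x. x \<in> U \<Longrightarrow> invertible (A x)"
    and "\<And>i j. (\<lambda>x. A x $ i $ j) differentiable (at p)"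
  shows "(\<lambda>x. matrix_inv (A x) $ k $ l) differentiable (at p)"
proof -
  have num: "(\<lambda>x. det (\<chi> i j. if j = k then axis l 1 $ i else A x $ i $ j)) differentiable (at p)"
  proof (rule differentiable_det)
    show "(\<lambda>x. (\<chi> i j. if j = k then axis l 1 $ i else A x $ i $ j) $ i $ j) differentiable (at p)" for i j
      using assms(4)[of i j] by (cases "j = k") simp_all
  qed
  have den: "(\<lambda>x. det (A x)) differentiable (at p)" "det (A p) \<noteq> 0"
    using differentiable_det[OF assms(4)] assms(2,3) invertible_det_nz by blast+
  show ?thesis
    by (rule differentiable_transform_open[OF assms(1,2) _ differentiable_divide[OF num den]])
      (rule matrix_inv_entry[OF assms(3), symmetric])
qed

lemma pd_entry:
  assumes "(G has_derivative G') (at x)"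
  shows "pd i (\<lambda>y. G y $ j $ l) x = G' (axis i 1) $ j $ l"
proof -
  have "((\<lambda>y. G y $ j $ l) has_derivative (\<lambda>h. G' h $ j $ l)) (at x)"
    by (intro bounded_linear.has_derivative[OF bounded_linear_vec_nth] assms)
  from frechet_derivative_at[OF this] show ?thesis by (metis pd_def)
qed

text \<open>Lowering the upper index turns Christoffel symbols into those of the first kind. In this
  form they are linear in the derivative of the metric, so no inverse matrix has to be computed;
  the lemma is used both for the given metric and for the Sasaki metric.\<close>

lemma metric_form_christoffel_map:
  fixes G :: "real^'n \<Rightarrow> real^'n^'n"
  assumes D: "(G has_derivative G') (at x)"
    and sym: "transpose (G x) = G x" and inv: "invertible (G x)"
  shows "metric_form (G x) (christoffel_map G x v w) u =
    (metric_form (G' v) w u + metric_form (G' w) v u - metric_form (G' u) v w) / 2"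
proof -
  define E where "E i j l = G' (axis i 1) $ j $ l" for i j l
  have lin: "linear G'" using D by (rule has_derivative_linear)
  have E: "metric_form (G' a) b c = (\<Sum>i\<in>UNIV. \<Sum>j\<in>UNIV. \<Sum>l\<in>UNIV. a $ i * b $ j * c $ l * E i j l)" for a b c
  proof -
    have "G' a = G' (\<Sum>i\<in>UNIV. a $ i *\<^sub>R axis i 1)"
      by (simp add: basis_expansion[of a, unfolded scalar_mult_eq_scaleR])
    also have "\<dots> = (\<Sum>i\<in>UNIV. a $ i *\<^sub>R G' (axis i 1))"
      by (simp add: linear_sum[OF lin] linear_scale[OF lin])
    finally have "metric_form (G' a) b c = (\<Sum>i\<in>UNIV. metric_form (a $ i *\<^sub>R G' (axis i 1)) b c)"
      by (simp only: linear_sum[OF bounded_linear.linear[OF bounded_linear_metric_form]])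
    then show ?thesis
      by (simp add: metric_form_scaleR metric_form_sum_entries E_def sum_distrib_left mult_ac)
  qed
  define T where "T = (\<chi> l. \<Sum>i\<in>UNIV. \<Sum>j\<in>UNIV. (E i j l + E j i l - E l i j) / 2 * v $ i * w $ j)"
  have "christoffel_map G x v w = matrix_inv (G x) *v T"
  proof -
    have "christoffel_map G x v w $ k = (matrix_inv (G x) *v T) $ k" for k
    proof -
      have "christoffel_map G x v w $ k = (\<Sum>i\<in>UNIV. \<Sum>j\<in>UNIV. \<Sum>l\<in>UNIV.
          matrix_inv (G x) $ k $ l * ((E i j l + E j i l - E l i j) / 2 * v $ i * w $ j))"
        by (simp add: christoffel_map_def christoffel_def pd_entry[OF D] E_def
            sum_distrib_left sum_distrib_right sum_divide_distrib field_simps)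
      also have "\<dots> = (\<Sum>i\<in>UNIV. \<Sum>l\<in>UNIV. \<Sum>j\<in>UNIV.
          matrix_inv (G x) $ k $ l * ((E i j l + E j i l - E l i j) / 2 * v $ i * w $ j))"
        by (intro sum.cong refl sum.swap)
      also have "\<dots> = (\<Sum>l\<in>UNIV. \<Sum>i\<in>UNIV. \<Sum>j\<in>UNIV.
          matrix_inv (G x) $ k $ l * ((E i j l + E j i l - E l i j) / 2 * v $ i * w $ j))"
        by (rule sum.swap)
      also have "\<dots> = (matrix_inv (G x) *v T) $ k"
        unfolding matrix_vector_mult_def T_def by (simp only: vec_lambda_beta sum_distrib_left)
      finally show ?thesis .
    qed
    then show ?thesis by (simp add: vec_eq_iff)
  qed
  then have "metric_form (G x) (christoffel_map G x v w) u = (G x *v (matrix_inv (G x) *v T)) \<bullet> u"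
    unfolding metric_form_def by (metis dot_lmul_matrix sym transpose_matrix_vector)
  also have "\<dots> = T \<bullet> u"
    using matrix_mul_matrix_inv[OF inv] by (simp add: matrix_vector_mul_assoc)
  also have "\<dots> = (\<Sum>l\<in>UNIV. \<Sum>i\<in>UNIV. \<Sum>j\<in>UNIV. (E i j l + E j i l - E l i j) / 2 * v $ i * w $ j * u $ l)"
    by (simp add: inner_vec_def T_def sum_distrib_right)
  also have "\<dots> = (metric_form (G' v) w u + metric_form (G' w) v u - metric_form (G' u) v w) / 2"
  proof -
    have rot: "(\<Sum>l\<in>UNIV. \<Sum>i\<in>UNIV. \<Sum>j\<in>UNIV. f l i j) = (\<Sum>i\<in>UNIV. \<Sum>j\<in>UNIV. \<Sum>l\<in>UNIV. f l i j)"
      for f :: "'n \<Rightarrow> 'n \<Rightarrow> 'n \<Rightarrow> real"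
    proof -
      have "(\<Sum>l\<in>UNIV. \<Sum>i\<in>UNIV. \<Sum>j\<in>UNIV. f l i j) = (\<Sum>i\<in>UNIV. \<Sum>l\<in>UNIV. \<Sum>j\<in>UNIV. f l i j)"
        by (rule sum.swap)
      also have "\<dots> = (\<Sum>i\<in>UNIV. \<Sum>j\<in>UNIV. \<Sum>l\<in>UNIV. f l i j)"
        by (intro sum.cong refl sum.swap)
      finally show ?thesis .
    qed
    have 1: "metric_form (G' v) w u = (\<Sum>l\<in>UNIV. \<Sum>i\<in>UNIV. \<Sum>j\<in>UNIV. E i j l * v $ i * w $ j * u $ l)"
      unfolding E by (rule trans[OF _ rot[symmetric]]) (simp add: mult_ac)
    have 2: "metric_form (G' w) v u = (\<Sum>l\<in>UNIV. \<Sum>i\<in>UNIV. \<Sum>j\<in>UNIV. E j i l * v $ i * w $ j * u $ l)"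
      unfolding E by (rule trans[OF sum.swap trans[OF _ rot[symmetric]]]) (simp add: mult_ac)
    have 3: "metric_form (G' u) v w = (\<Sum>l\<in>UNIV. \<Sum>i\<in>UNIV. \<Sum>j\<in>UNIV. E l i j * v $ i * w $ j * u $ l)"
      unfolding E by (simp add: mult_ac)
    show ?thesis
      unfolding 1 2 3
      by (simp add: sum.distrib[symmetric] sum_subtractf[symmetric] sum_divide_distrib algebra_simps
          add_divide_distrib diff_divide_distrib)
  qed
  finally show ?thesis .
qed

lemma christoffel_map_linear:
  "christoffel_map G x (v + v') w = christoffel_map G x v w + christoffel_map G x v' w"
  "christoffel_map G x v (w + w') = christoffel_map G x v w + christoffel_map G x v w'"
  "christoffel_map G x (c *\<^sub>R v) w = c *\<^sub>R christoffel_map G x v w"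
  "christoffel_map G x v (c *\<^sub>R w) = c *\<^sub>R christoffel_map G x v w"
  by (simp_all add: christoffel_map_def vec_eq_iff algebra_simps sum.distrib sum_distrib_left)

lemma christoffel_map_zero [simp]: "christoffel_map G x 0 w = 0" "christoffel_map G x v 0 = 0"
  by (simp_all add: christoffel_map_def vec_eq_iff)

lemma christoffel_map_minus:
  "christoffel_map G x (- v) w = - christoffel_map G x v w"
  "christoffel_map G x v (- w) = - christoffel_map G x v w"
  by (simp_all add: christoffel_map_def vec_eq_iff sum_negf)

text \<open>The derivative of \<open>christoffel_map\<close> in the base point, in direction \<open>a\<close>, written through
  the symbols so that it is visibly bilinear in \<open>v\<close> and \<open>w\<close>.\<close>

definition christoffel_map_deriv ::
    "(real^'n \<Rightarrow> real^'n^'n) \<Rightarrow> real^'n \<Rightarrow> real^'n \<Rightarrow> real^'n \<Rightarrow> real^'n \<Rightarrow> real^'n::finite" where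
  "christoffel_map_deriv G x a v w = (\<Sum>i\<in>UNIV. \<Sum>j\<in>UNIV.
     (v $ i * w $ j) *\<^sub>R frechet_derivative (\<lambda>y. \<chi> k. christoffel G y k i j) (at x) a)"

lemma christoffel_map_deriv_linear:
  "christoffel_map_deriv G x a (v + v') w = christoffel_map_deriv G x a v w + christoffel_map_deriv G x a v' w"
  "christoffel_map_deriv G x a v (w + w') = christoffel_map_deriv G x a v w + christoffel_map_deriv G x a v w'"
  "christoffel_map_deriv G x a (c *\<^sub>R v) w = c *\<^sub>R christoffel_map_deriv G x a v w"
  "christoffel_map_deriv G x a v (c *\<^sub>R w) = c *\<^sub>R christoffel_map_deriv G x a v w"
  by (simp_all add: christoffel_map_deriv_def algebra_simps sum.distrib scaleR_sum_right)

text \<open>A Riemannian metric given by its matrix of components on an open set of coordinates. Two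
  derivatives are what the curvature needs.\<close>

locale chart_metric =
  fixes g :: "real^'n \<Rightarrow> real^'n^'n::finite" and U :: "(real^'n) set"
  assumes open_domain: "open U"
    and C2: "Ck_on 2 U g"
    and symmetric: "\<And>x. x \<in> U \<Longrightarrow> transpose (g x) = g x"
    and positive: "\<And>x v. x \<in> U \<Longrightarrow> v \<noteq> 0 \<Longrightarrow> metric_form (g x) v v > 0"
begin

abbreviation "Dg x \<equiv> frechet_derivative g (at x)"
abbreviation "\<Gamma> \<equiv> christoffel_map g"
abbreviation "D\<Gamma> \<equiv> christoffel_map_deriv g"

lemma has_derivative_metric: "x \<in> U \<Longrightarrow> (g has_derivative Dg x) (at x)"
  using C2 by (simp add: numeral_2_eq_2 frechet_derivative_works)

lemmas Dg_linear = has_derivative_metric[THEN has_derivative_linear]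

lemma invertible: "x \<in> U \<Longrightarrow> invertible (g x)"
  using positive by (intro invertible_if_positive_definite)

lemma commute: "x \<in> U \<Longrightarrow> metric_form (g x) v w = metric_form (g x) w v"
  using metric_form_commute symmetric by blast

lemma nondegenerate:
  assumes "x \<in> U" "\<And>u. metric_form (g x) v u = metric_form (g x) w u"
  shows "v = w"
  using positive[OF assms(1)] assms(2) by (rule positive_definite_nondegenerate)

lemma Dg_commute:
  assumes x: "x \<in> U"
  shows "metric_form (Dg x a) v w = metric_form (Dg x a) w v"
proof -
  have "((\<lambda>y. metric_form (g y) v w) has_derivative (\<lambda>h. metric_form (Dg x h) v w)) (at x)" for v w
    by (intro bounded_linear.has_derivative[OF bounded_linear_metric_form] has_derivative_metric x)
  note this[of v w] has_derivative_transform_within_open[OF this[of w v] open_domain x, of "\<lambda>y. metric_form (g y) v w"]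
  from has_derivative_unique[OF this] show ?thesis using commute by metis
qed

lemma lowered_\<Gamma>:
  assumes "x \<in> U"
  shows "metric_form (g x) (\<Gamma> x v w) u =
    (metric_form (Dg x v) w u + metric_form (Dg x w) v u - metric_form (Dg x u) v w) / 2"
  using assms by (intro metric_form_christoffel_map has_derivative_metric symmetric invertible)

lemma \<Gamma>_commute:
  assumes "x \<in> U"
  shows "\<Gamma> x v w = \<Gamma> x w v"
proof (rule nondegenerate[OF assms])
  show "metric_form (g x) (\<Gamma> x v w) u = metric_form (g x) (\<Gamma> x w v) u" for u
    using Dg_commute[OF assms, of u v w] by (simp add: lowered_\<Gamma>[OF assms])
qed

text \<open>The metric is parallel, \<open>\<nabla>g = 0\<close>; all cancellations below rest on this identity.\<close>

lemma Dg_eq_\<Gamma>: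
  assumes "x \<in> U"
  shows "metric_form (Dg x a) v w = metric_form (g x) (\<Gamma> x v a) w + metric_form (g x) v (\<Gamma> x w a)"
  using assms by (simp add: commute[of x v] lowered_\<Gamma> Dg_commute[of x _ v w] Dg_commute[of x _ a] field_simps)

text \<open>The Christoffel symbols contain first derivatives of the metric, so this is where its second
  derivatives enter.\<close>

lemma differentiable_christoffel:
  assumes x: "x \<in> U"
  shows "(\<lambda>y. \<chi> k. christoffel g y k i j) differentiable (at x)"
proof -
  have entry: "(\<lambda>y. g y $ a $ b) differentiable (at x)" for a b
    using bounded_linear.has_derivative[OF bounded_linear_vec_nth
        bounded_linear.has_derivative[OF bounded_linear_vec_nth has_derivative_metric[OF x]]]
    by (auto simp: differentiable_def)
  have pd: "(\<lambda>y. pd c (\<lambda>y. g y $ a $ b) y) differentiable (at x)" for a b c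
  proof -
    have "(\<lambda>y. Dg y (axis c 1)) differentiable (at x)"
      using C2 x by (simp add: numeral_2_eq_2)
    then have "((\<lambda>y. Dg y (axis c 1) $ a $ b) has_derivative
        (\<lambda>h. frechet_derivative (\<lambda>y. Dg y (axis c 1)) (at x) h $ a $ b)) (at x)"
      by (intro bounded_linear.has_derivative[OF bounded_linear_vec_nth]) (simp add: frechet_derivative_works)
    from has_derivative_transform_within_open[OF this open_domain x]
    have "((\<lambda>y. pd c (\<lambda>y. g y $ a $ b) y) has_derivative
        (\<lambda>h. frechet_derivative (\<lambda>y. Dg y (axis c 1)) (at x) h $ a $ b)) (at x)"
      using pd_entry[OF has_derivative_metric] by simp
    then show ?thesis by (auto simp: differentiable_def)
  qed
  have "(\<lambda>y. matrix_inv (g y) $ k $ l * (pd i (\<lambda>y. g y $ j $ l) y + pd j (\<lambda>y. g y $ i $ l) y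
      - pd l (\<lambda>y. g y $ i $ j) y)) differentiable (at x)" for k l
    by (intro differentiable_mult differentiable_diff differentiable_add pd
        differentiable_matrix_inv_entry[OF open_domain x invertible entry])
  then have *: "(\<lambda>y. christoffel g y k i j) differentiable (at x)" for k
    unfolding christoffel_def by (intro differentiable_mult differentiable_sum) simp_all
  have "(\<chi> k. christoffel g y k i j) = (\<Sum>k\<in>UNIV. christoffel g y k i j *\<^sub>R axis k 1)" for y
    using basis_expansion[of "\<chi> k. christoffel g y k i j", unfolded scalar_mult_eq_scaleR] by simp
  then show ?thesis
    using * by (auto intro!: differentiable_sum differentiable_scaleR)
qed

lemma has_derivative_\<Gamma>:
  fixes X :: "'p::real_normed_vector \<Rightarrow> real^'n"
  assumes X: "(X has_derivative X') (at p)" "X p \<in> U"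
    and V: "(V has_derivative V') (at p)" and W: "(W has_derivative W') (at p)"
  shows "((\<lambda>p. \<Gamma> (X p) (V p) (W p)) has_derivative
    (\<lambda>h. D\<Gamma> (X p) (X' h) (V p) (W p) + \<Gamma> (X p) (V' h) (W p) + \<Gamma> (X p) (V p) (W' h))) (at p)"
proof -
  define C where "C i j y = (\<chi> k. christoffel g y k i j)" for i j y
  have \<Gamma>: "\<Gamma> y v w = (\<Sum>i\<in>UNIV. \<Sum>j\<in>UNIV. (v $ i * w $ j) *\<^sub>R C i j y)" for y v w
    by (simp add: christoffel_map_def C_def vec_eq_iff mult_ac)
  have nth: "((\<lambda>p. F p $ i) has_derivative (\<lambda>h. F' h $ i)) (at p)"
    if "(F has_derivative F') (at p)" for F :: "'p \<Rightarrow> real^'n" and F' i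
    using that by (rule bounded_linear.has_derivative[OF bounded_linear_vec_nth])
  have C: "((\<lambda>p. C i j (X p)) has_derivative (\<lambda>h. frechet_derivative (C i j) (at (X p)) (X' h))) (at p)" for i j
    using differentiable_christoffel[OF X(2)]
    by (intro has_derivative_compose[OF X(1)]) (simp add: C_def[abs_def] frechet_derivative_works)
  have "((\<lambda>p. \<Sum>i\<in>UNIV. \<Sum>j\<in>UNIV. (V p $ i * W p $ j) *\<^sub>R C i j (X p)) has_derivative
     (\<lambda>h. \<Sum>i\<in>UNIV. \<Sum>j\<in>UNIV. (V p $ i * W p $ j) *\<^sub>R frechet_derivative (C i j) (at (X p)) (X' h)
        + (V p $ i * W' h $ j + V' h $ i * W p $ j) *\<^sub>R C i j (X p))) (at p)"
    by (intro has_derivative_sum has_derivative_scaleR has_derivative_mult nth C V W)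
  then show ?thesis
    unfolding \<Gamma> christoffel_map_deriv_def C_def[abs_def]
    by (simp add: sum.distrib scaleR_add_left add_ac)
qed

text \<open>\<open>\<langle>R(a, n)u, u\<rangle> = 0\<close>. Since \<open>\<langle>u, \<Gamma>(u, n)\<rangle>\<close> is half the derivative of
  \<open>\<langle>u, u\<rangle>\<close> in direction \<open>n\<close>, its derivative in direction \<open>a\<close> is a second derivative of the
  metric and hence symmetric in \<open>a\<close> and \<open>n\<close>.\<close>

lemma curvature_skew:
  assumes x: "x \<in> U"
  shows "metric_form (g x) u (D\<Gamma> x a u n) + metric_form (g x) u (\<Gamma> x (\<Gamma> x u n) a)
    = metric_form (g x) u (D\<Gamma> x n u a) + metric_form (g x) u (\<Gamma> x (\<Gamma> x u a) n)"
proof -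
  define f where "f y = metric_form (g y) u u" for y
  have f: "(f has_derivative (\<lambda>h. metric_form (Dg y h) u u)) (at y)" if "y \<in> U" for y
    unfolding f_def[abs_def]
    by (intro bounded_linear.has_derivative[OF bounded_linear_metric_form] has_derivative_metric that)
  have "Ck_on 2 U f"
    unfolding f_def[abs_def]
    by (intro bounded_linear.Ck_on[OF bounded_linear_metric_form] open_domain C2)
  note Young = iterated_derivative_symmetric[OF open_domain x this]
  have "frechet_derivative (\<lambda>y. frechet_derivative f (at y) n) (at x) a
    = 2 * (metric_form (Dg x a) u (\<Gamma> x u n) + metric_form (g x) u (D\<Gamma> x a u n))" for a n
  proof -
    have "((\<lambda>y. 2 * metric_form (g y) u (\<Gamma> y u n)) has_derivative
        (\<lambda>a. 2 * (metric_form (Dg x a) u (\<Gamma> x u n) + metric_form (g x) u (D\<Gamma> x a u n)))) (at x)"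
      using has_derivative_metric_form[OF has_derivative_metric[OF x] has_derivative_const[of u]
          has_derivative_\<Gamma>[OF has_derivative_ident x has_derivative_const[of u] has_derivative_const[of n]]]
      by (intro has_derivative_mult_right) simp
    moreover have "2 * metric_form (g y) u (\<Gamma> y u n) = frechet_derivative f (at y) n" if "y \<in> U" for y
      using fun_cong[OF frechet_derivative_at[OF f[OF that]], of n] Dg_eq_\<Gamma>[OF that, of n u u]
        commute[OF that, of "\<Gamma> y u n" u] by simp
    ultimately have "((\<lambda>y. frechet_derivative f (at y) n) has_derivative
        (\<lambda>a. 2 * (metric_form (Dg x a) u (\<Gamma> x u n) + metric_form (g x) u (D\<Gamma> x a u n)))) (at x)"
      by (rule has_derivative_transform_within_open[OF _ open_domain x])
    from fun_cong[OF frechet_derivative_at[OF this], of a] show ?thesis by simp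
  qed
  with Young[of n a] show ?thesis
    by (simp add: Dg_eq_\<Gamma>[OF x] commute[OF x, of "\<Gamma> x u n" "\<Gamma> x u a"] )
qed

end

lemma (in chart_metric) D\<Gamma>_scale_direction:
  assumes "x \<in> U"
  shows "D\<Gamma> x (c *\<^sub>R a) v w = c *\<^sub>R D\<Gamma> x a v w"
  using differentiable_christoffel[OF assms]
  by (simp add: christoffel_map_deriv_def scaleR_sum_right mult_ac
      frechet_derivative_works[THEN iffD1, THEN has_derivative_linear, THEN linear_scale])

section \<open>The Sasaki metric in an induced chart\<close>

lemma base_part_join [simp]: "base_part (join x \<xi>) = x"
  and fibre_part_join [simp]: "fibre_part (join x \<xi>) = \<xi>"
  by (simp_all add: base_part_def fibre_part_def join_def)

lemma bundle_part_eqI: "base_part z = base_part w \<Longrightarrow> fibre_part z = fibre_part w \<Longrightarrow> z = w"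
  by (auto simp: base_part_def fibre_part_def vec_eq_iff split_sum_all)

lemma linear_base_part: "linear base_part" and linear_fibre_part: "linear fibre_part"
  by (auto simp: base_part_def fibre_part_def vec_eq_iff intro!: linearI)

lemmas bundle_parts_linear =
  linear_add[OF linear_base_part] linear_scale[OF linear_base_part]
  linear_add[OF linear_fibre_part] linear_scale[OF linear_fibre_part]

lemma linear_join: "linear (\<lambda>p. join (fst p) (snd p))"
  by (auto simp: join_def vec_eq_iff split: sum.split intro!: linearI)

lemma has_derivative_join:
  assumes "(f has_derivative f') (at p)" "(g has_derivative g') (at p)"
  shows "((\<lambda>x. join (f x) (g x)) has_derivative (\<lambda>h. join (f' h) (g' h))) (at p)"
  using bounded_linear.has_derivative[OF linear_join[unfolded linear_conv_bounded_linear]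
      has_derivative_Pair[OF assms]] by simp

lemma has_derivative_base_part: "(base_part has_derivative base_part) F"
  and has_derivative_fibre_part: "(fibre_part has_derivative fibre_part) F"
  using linear_base_part linear_fibre_part
  by (auto simp: linear_conv_bounded_linear intro: bounded_linear_imp_has_derivative)

locale bundle_chart = chart_metric "metric M i" U
  for M :: "('i, 'a, 'n::finite) riemannian" and i and U
begin

abbreviation "g \<equiv> metric M i"
abbreviation "G \<equiv> metric (tangent_bundle M) i"
abbreviation "K \<equiv> connection_map M i"

lemma K_linear:
  "K z (X + Y) = K z X + K z Y" "K z (r *\<^sub>R X) = r *\<^sub>R K z X"
  by (simp_all add: connection_map_def bundle_parts_linear christoffel_map_linear scaleR_add_right)

lemma metric_form_G: "metric_form (G z) X Y = sasaki_form M i z X Y"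
proof -
  have lin1: "linear (\<lambda>X. sasaki_form M i z X Y)" and lin2: "linear (sasaki_form M i z X)" for X Y
    by (auto intro!: linearI simp: sasaki_form_def K_linear bundle_parts_linear metric_form_linear algebra_simps)
  have expand: "X = (\<Sum>a\<in>UNIV. X $ a *\<^sub>R axis a 1)" for X :: "real^('n + 'n)"
    using basis_expansion[of X, unfolded scalar_mult_eq_scaleR] by simp
  have "sasaki_form M i z X Y = (\<Sum>a\<in>UNIV. X $ a * sasaki_form M i z (axis a 1) Y)"
    by (subst expand[of X]) (simp only: linear_sum[OF lin1] linear_scale[OF lin1] real_scaleR_def)
  also have "\<dots> = (\<Sum>a\<in>UNIV. X $ a * (\<Sum>b\<in>UNIV. Y $ b * sasaki_form M i z (axis a 1) (axis b 1)))"
    by (subst expand[of Y]) (simp only: linear_sum[OF lin2] linear_scale[OF lin2] real_scaleR_def)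
  also have "\<dots> = metric_form (G z) X Y"
    by (simp add: metric_form_sum_entries tangent_bundle_def sum_distrib_left mult.assoc)
  finally show ?thesis ..
qed

lemma G_symmetric: "base_part z \<in> U \<Longrightarrow> transpose (G z) = G z"
  by (auto simp: tangent_bundle_def transpose_def vec_eq_iff sasaki_form_def intro!: arg_cong2[of _ _ _ _ "(+)"] commute)

lemma G_positive:
  assumes z: "base_part z \<in> U" and X: "X \<noteq> 0"
  shows "metric_form (G z) X X > 0"
proof -
  have nonneg: "metric_form (g (base_part z)) v v \<ge> 0" for v
    using positive[OF z, of v] by (cases "v = 0") auto
  show ?thesis
  proof (cases "base_part X = 0")
    case True
    then have "fibre_part X \<noteq> 0"
      using X bundle_part_eqI[of X 0] linear_0[OF linear_base_part] linear_0[OF linear_fibre_part] by auto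
    with True positive[OF z] show ?thesis
      by (simp add: metric_form_G sasaki_form_def connection_map_def)
  next
    case False
    with positive[OF z False] nonneg show ?thesis
      by (simp add: metric_form_G sasaki_form_def add_pos_nonneg)
  qed
qed

text \<open>\<open>K_deriv\<close> and \<open>G_deriv\<close> are the derivatives of \<open>K\<close> and of the Sasaki metric in the
  coordinates of the point \<open>z\<close>, in direction \<open>a\<close>, with the components of the arguments held
  fixed.\<close>

definition K_deriv :: "real^('n + 'n) \<Rightarrow> real^('n + 'n) \<Rightarrow> real^('n + 'n) \<Rightarrow> real^'n" where
  "K_deriv z a X = D\<Gamma> (base_part z) (base_part a) (fibre_part z) (base_part X)
     + \<Gamma> (base_part z) (fibre_part a) (base_part X)"

definition G_deriv :: "real^('n + 'n) \<Rightarrow> real^('n + 'n) \<Rightarrow> real^('n + 'n) \<Rightarrow> real^('n + 'n) \<Rightarrow> real" where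
  "G_deriv z a X Y =
     metric_form (Dg (base_part z) (base_part a)) (base_part X) (base_part Y)
   + metric_form (Dg (base_part z) (base_part a)) (K z X) (K z Y)
   + metric_form (g (base_part z)) (K_deriv z a X) (K z Y)
   + metric_form (g (base_part z)) (K z X) (K_deriv z a Y)"

lemma has_derivative_K:
  assumes "base_part z \<in> U"
  shows "((\<lambda>z. K z X) has_derivative (\<lambda>a. K_deriv z a X)) (at z)"
  using has_derivative_add[OF has_derivative_const[of "fibre_part X"]
      has_derivative_\<Gamma>[OF has_derivative_base_part assms has_derivative_fibre_part has_derivative_const[of "base_part X"]]]
  by (simp add: connection_map_def K_deriv_def)

lemma has_derivative_G:
  assumes z: "base_part z \<in> U"
  shows "((\<lambda>z. metric_form (G z) X Y) has_derivative (\<lambda>a. G_deriv z a X Y)) (at z)"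
proof -
  have "((\<lambda>z. g (base_part z)) has_derivative (\<lambda>a. Dg (base_part z) (base_part a))) (at z)"
    by (intro has_derivative_compose[OF has_derivative_base_part] has_derivative_metric z)
  note D = has_derivative_metric_form[OF this]
  show ?thesis
    unfolding metric_form_G sasaki_form_def
    using has_derivative_add[OF D[OF has_derivative_const[of "base_part X"] has_derivative_const[of "base_part Y"]]
        D[OF has_derivative_K[OF z, of X] has_derivative_K[OF z, of Y]]]
    by (simp add: G_deriv_def add.assoc)
qed

lemma lowered_christoffel_G:
  assumes z: "base_part z \<in> U"
  shows "metric_form (G z) (christoffel_map G z X Y) \<nu>
    = (G_deriv z X Y \<nu> + G_deriv z Y X \<nu> - G_deriv z \<nu> X Y) / 2"
proof -
  obtain G' where G': "(G has_derivative G') (at z)" "\<And>a X Y. metric_form (G' a) X Y = G_deriv z a X Y"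
    using has_derivative_metricE[OF has_derivative_G[OF z]] by metis
  have "invertible (G z)" by (intro invertible_if_positive_definite G_positive z)
  from metric_form_christoffel_map[OF G'(1) G_symmetric[OF z] this] show ?thesis
    by (simp add: G'(2))
qed

end

section \<open>The cylinder in an induced chart\<close>

text \<open>\<open>T\<close> is a set of parameters for which the geodesic stays in one chart; \<open>c\<close> and \<open>\<epsilon>\<close> are
  the coordinates of the geodesic and of the parallel field. The derivatives are parameters, so that
  the computation only uses the geodesic equation and the equation of parallel transport, both
  solved for the highest derivative.\<close>

locale cylinder_chart = bundle_chart M i U
  for M :: "('i, 'a, 'n::finite) riemannian" and i and U +
  fixes T :: "real set"
    and c c' c'' \<epsilon> \<epsilon>' \<epsilon>'' :: "real \<Rightarrow> real^'n"
    and \<rho> \<rho>' \<rho>'' :: "real \<Rightarrow> real"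
  assumes open_params: "open T"
    and c_in: "\<And>s. s \<in> T \<Longrightarrow> c s \<in> U"
    and c: "\<And>s. s \<in> T \<Longrightarrow> (c has_vector_derivative c' s) (at s)"
    and c': "\<And>s. s \<in> T \<Longrightarrow> (c' has_vector_derivative c'' s) (at s)"
    and \<epsilon>: "\<And>s. s \<in> T \<Longrightarrow> (\<epsilon> has_vector_derivative \<epsilon>' s) (at s)"
    and \<epsilon>': "\<And>s. s \<in> T \<Longrightarrow> (\<epsilon>' has_vector_derivative \<epsilon>'' s) (at s)"
    and \<rho>: "\<And>s. s \<in> T \<Longrightarrow> (\<rho> has_vector_derivative \<rho>' s) (at s)"
    and \<rho>': "\<And>s. s \<in> T \<Longrightarrow> (\<rho>' has_vector_derivative \<rho>'' s) (at s)"
    and geodesic: "\<And>s. s \<in> T \<Longrightarrow> c'' s = - \<Gamma> (c s) (c' s) (c' s)"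
    and parallel: "\<And>s. s \<in> T \<Longrightarrow> \<Gamma> (c s) (\<epsilon> s) (c' s) = - \<epsilon>' s"
    and unit: "\<And>s. s \<in> T \<Longrightarrow> metric_form (metric M i (c s)) (\<epsilon> s) (\<epsilon> s) = 1"
begin

definition P :: "real^2 \<Rightarrow> real^('n + 'n)" where
  "P u = join (c (u $ 1)) ((u $ 2 * \<rho> (u $ 1)) *\<^sub>R \<epsilon> (u $ 1))"

text \<open>\<open>\<alpha>\<close> and \<open>\<beta>\<close> are the first and second derivatives of the function \<open>t \<rho>(s)\<close> of
  \<open>u = (s, t)\<close>.\<close>

definition \<alpha> :: "real^2 \<Rightarrow> real^2 \<Rightarrow> real" where
  "\<alpha> u v = v $ 2 * \<rho> (u $ 1) + u $ 2 * \<rho>' (u $ 1) * v $ 1"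

definition \<beta> :: "real^2 \<Rightarrow> real^2 \<Rightarrow> real^2 \<Rightarrow> real" where
  "\<beta> u v w = u $ 2 * \<rho>'' (u $ 1) * v $ 1 * w $ 1 + \<rho>' (u $ 1) * (v $ 1 * w $ 2 + v $ 2 * w $ 1)"

definition P_deriv :: "real^2 \<Rightarrow> real^2 \<Rightarrow> real^('n + 'n)" where
  "P_deriv u v = join (v $ 1 *\<^sub>R c' (u $ 1))
     (\<alpha> u v *\<^sub>R \<epsilon> (u $ 1) + (u $ 2 * \<rho> (u $ 1) * v $ 1) *\<^sub>R \<epsilon>' (u $ 1))"

definition P_deriv2 :: "real^2 \<Rightarrow> real^2 \<Rightarrow> real^2 \<Rightarrow> real^('n + 'n)" where
  "P_deriv2 u v w = join ((v $ 1 * w $ 1) *\<^sub>R c'' (u $ 1))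
     (\<beta> u v w *\<^sub>R \<epsilon> (u $ 1) + (v $ 1 * \<alpha> u w + w $ 1 * \<alpha> u v) *\<^sub>R \<epsilon>' (u $ 1)
      + (u $ 2 * \<rho> (u $ 1) * v $ 1 * w $ 1) *\<^sub>R \<epsilon>'' (u $ 1))"

lemma P_parts: "base_part (P u) = c (u $ 1)" "fibre_part (P u) = (u $ 2 * \<rho> (u $ 1)) *\<^sub>R \<epsilon> (u $ 1)"
  by (simp_all add: P_def)

lemma P_in: "u $ 1 \<in> T \<Longrightarrow> base_part (P u) \<in> U"
  by (simp add: P_parts c_in)

lemma has_derivative_first_coordinate:
  fixes u :: "real^2"
  assumes "(f has_vector_derivative f') (at (u $ 1))"
  shows "((\<lambda>u. f (u $ 1)) has_derivative (\<lambda>v. v $ 1 *\<^sub>R f')) (at u)"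
  using has_derivative_compose[OF bounded_linear_imp_has_derivative[OF bounded_linear_vec_nth]
      assms[unfolded has_vector_derivative_def]] .

lemmas has_derivative_c = c[THEN has_derivative_first_coordinate]
lemmas has_derivative_c' = c'[THEN has_derivative_first_coordinate]
lemmas has_derivative_\<epsilon> = \<epsilon>[THEN has_derivative_first_coordinate]
lemmas has_derivative_\<epsilon>' = \<epsilon>'[THEN has_derivative_first_coordinate]
lemmas has_derivative_\<rho> = \<rho>[THEN has_derivative_first_coordinate]
lemmas has_derivative_\<rho>' = \<rho>'[THEN has_derivative_first_coordinate]

lemma has_derivative_\<tau>:
  fixes u :: "real^2"
  assumes "u $ 1 \<in> T"
  shows "((\<lambda>u. u $ 2 * \<rho> (u $ 1)) has_derivative \<alpha> u) (at u)"
  by (rule has_derivative_eq_rhs[OF has_derivative_mult[OF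
        bounded_linear_imp_has_derivative[OF bounded_linear_vec_nth] has_derivative_\<rho>[OF assms]]])
    (auto simp: \<alpha>_def)

lemma has_derivative_\<alpha>:
  assumes "u $ 1 \<in> T"
  shows "((\<lambda>r. \<alpha> r w) has_derivative (\<lambda>v. \<beta> u v w)) (at u)"
  unfolding \<alpha>_def
  by (rule has_derivative_eq_rhs[OF has_derivative_add[OF
        has_derivative_mult[OF has_derivative_const has_derivative_\<rho>[OF assms]]
        has_derivative_mult[OF has_derivative_mult[OF bounded_linear_imp_has_derivative[OF bounded_linear_vec_nth]
          has_derivative_\<rho>'[OF assms]] has_derivative_const]]])
    (auto simp: \<beta>_def algebra_simps)

lemma has_derivative_P:
  assumes u: "u $ 1 \<in> T"
  shows "(P has_derivative P_deriv u) (at u)"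
proof -
  have "((\<lambda>u. (u $ 2 * \<rho> (u $ 1)) *\<^sub>R \<epsilon> (u $ 1)) has_derivative
      (\<lambda>v. \<alpha> u v *\<^sub>R \<epsilon> (u $ 1) + (u $ 2 * \<rho> (u $ 1) * v $ 1) *\<^sub>R \<epsilon>' (u $ 1))) (at u)"
    by (rule has_derivative_eq_rhs[OF has_derivative_scaleR[OF has_derivative_\<tau>[OF u] has_derivative_\<epsilon>[OF u]]])
      auto
  from has_derivative_join[OF has_derivative_c[OF u] this] show ?thesis
    by (simp add: P_def[abs_def] P_deriv_def[abs_def])
qed

lemma has_derivative_P_deriv:
  assumes u: "u $ 1 \<in> T"
  shows "((\<lambda>r. P_deriv r w) has_derivative (\<lambda>v. P_deriv2 u v w)) (at u)"
  unfolding P_deriv_def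
  by (rule has_derivative_eq_rhs[OF has_derivative_join[OF
        has_derivative_scaleR[OF has_derivative_const has_derivative_c'[OF u]]
        has_derivative_add[OF has_derivative_scaleR[OF has_derivative_\<alpha>[OF u] has_derivative_\<epsilon>[OF u]]
          has_derivative_scaleR[OF has_derivative_mult[OF has_derivative_\<tau>[OF u] has_derivative_const]
            has_derivative_\<epsilon>'[OF u]]]]])
    (auto simp: P_deriv2_def algebra_simps)

text \<open>Because \<open>\<epsilon>\<close> is parallel, the vertical part of every tangent vector of the cylinder is a multiple
  of \<open>\<epsilon>\<close>.\<close>

lemma K_P_deriv:
  assumes "u $ 1 \<in> T"
  shows "K (P u) (P_deriv u v) = \<alpha> u v *\<^sub>R \<epsilon> (u $ 1)"
  using parallel[OF assms] by (simp add: connection_map_def P_parts P_deriv_def christoffel_map_linear mult_ac)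

text \<open>Differentiating the equation of parallel transport brings in the derivative of the Christoffel
  symbols, which later combines with that in \<open>K_deriv\<close> to a curvature term.\<close>

lemma parallel_deriv:
  assumes s: "s \<in> T"
  shows "\<epsilon>'' s = - (D\<Gamma> (c s) (c' s) (\<epsilon> s) (c' s) + \<Gamma> (c s) (\<epsilon>' s) (c' s) + \<Gamma> (c s) (\<epsilon> s) (c'' s))"
proof -
  have "((\<lambda>s. - \<Gamma> (c s) (\<epsilon> s) (c' s)) has_derivative
      (\<lambda>h. - (D\<Gamma> (c s) (h *\<^sub>R c' s) (\<epsilon> s) (c' s) + \<Gamma> (c s) (h *\<^sub>R \<epsilon>' s) (c' s) + \<Gamma> (c s) (\<epsilon> s) (h *\<^sub>R c'' s)))) (at s)"
    using c[OF s] \<epsilon>[OF s] c'[OF s] c_in[OF s]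
    by (intro has_derivative_minus has_derivative_\<Gamma>) (simp_all add: has_vector_derivative_def)
  from has_derivative_transform_within_open[OF this open_params s, of \<epsilon>']
  have "(\<epsilon>' has_derivative (\<lambda>h. - (D\<Gamma> (c s) (h *\<^sub>R c' s) (\<epsilon> s) (c' s) + \<Gamma> (c s) (h *\<^sub>R \<epsilon>' s) (c' s)
       + \<Gamma> (c s) (\<epsilon> s) (h *\<^sub>R c'' s)))) (at s)"
    using parallel by simp
  from has_derivative_unique[OF this \<epsilon>'[OF s, unfolded has_vector_derivative_def], THEN fun_cong, of 1]
  show ?thesis by simp
qed

text \<open>In the Sasaki metric the covariant derivative \<open>\<nabla>\<^sub>v P\<^sub>w\<close> of the coordinate fields is
  \<open>\<beta> u v w\<close> times the vertical lift of \<open>\<epsilon>\<close>. Paired with \<open>\<nu>\<close> it consists of a horizontal part, which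
  vanishes by the geodesic equation, of terms with \<open>\<epsilon>'\<close>, which cancel since \<open>\<epsilon>\<close> is parallel and
  the metric is parallel, and of derivatives of Christoffel symbols. The fibre coordinate and the
  vertical parts of the tangent vectors are all multiples of \<open>\<epsilon>\<close>, so the latter occur only in the
  combination \<open>\<langle>R(c', n)\<epsilon>, \<epsilon>\<rangle> = 0\<close>, where \<open>n\<close> is the horizontal part of \<open>\<nu>\<close>.\<close>

lemma cov_deriv_P:
  assumes u: "u $ 1 \<in> T"
  shows "metric_form (G (P u)) (P_deriv2 u v w + christoffel_map G (P u) (P_deriv u v) (P_deriv u w)) \<nu>
    = \<beta> u v w * metric_form (g (c (u $ 1))) (\<epsilon> (u $ 1)) (K (P u) \<nu>)"
proof -
  define s where "s = u $ 1"
  define x where "x = c s"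
  define \<tau> where "\<tau> = u $ 2 * \<rho> s"
  define n1 where "n1 = base_part \<nu>"
  define n2 where "n2 = fibre_part \<nu>"
  define N where "N = K (P u) \<nu>"
  define a where "a = \<alpha> u v"
  define b where "b = \<alpha> u w"
  have s: "s \<in> T" and x: "x \<in> U" using u c_in by (auto simp: s_def x_def)
  have z: "base_part (P u) = x" "fibre_part (P u) = \<tau> *\<^sub>R \<epsilon> s"
    by (simp_all add: P_parts s_def x_def \<tau>_def)
  have parts: "base_part (P_deriv u v) = v $ 1 *\<^sub>R c' s" "base_part (P_deriv u w) = w $ 1 *\<^sub>R c' s"
    "fibre_part (P_deriv u v) = a *\<^sub>R \<epsilon> s + (\<tau> * v $ 1) *\<^sub>R \<epsilon>' s"
    "fibre_part (P_deriv u w) = b *\<^sub>R \<epsilon> s + (\<tau> * w $ 1) *\<^sub>R \<epsilon>' s"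
    by (simp_all add: P_deriv_def s_def a_def b_def \<tau>_def)
  have K: "K (P u) (P_deriv u v) = a *\<^sub>R \<epsilon> s" "K (P u) (P_deriv u w) = b *\<^sub>R \<epsilon> s"
    using K_P_deriv[OF u] by (simp_all add: s_def a_def b_def)
  have N: "N = n2 + \<tau> *\<^sub>R \<Gamma> x (\<epsilon> s) n1"
    by (simp add: N_def connection_map_def z christoffel_map_linear n1_def n2_def)
  have par: "\<Gamma> x (\<epsilon> s) (c' s) = - \<epsilon>' s" using parallel[OF s] by (simp add: x_def)
  have geo: "c'' s = - \<Gamma> x (c' s) (c' s)" using geodesic[OF s] by (simp add: x_def)
  have par': "\<epsilon>'' s + \<Gamma> x (\<epsilon> s) (c'' s) = - (D\<Gamma> x (c' s) (\<epsilon> s) (c' s) + \<Gamma> x (\<epsilon>' s) (c' s))"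
    using parallel_deriv[OF s] by (simp add: x_def)
  have K2: "K (P u) (P_deriv2 u v w) = \<beta> u v w *\<^sub>R \<epsilon> s + (v $ 1 * b + w $ 1 * a) *\<^sub>R \<epsilon>' s
      + (\<tau> * v $ 1 * w $ 1) *\<^sub>R (\<epsilon>'' s + \<Gamma> x (\<epsilon> s) (c'' s))"
    by (simp add: connection_map_def z P_deriv2_def christoffel_map_linear scaleR_add_right)
      (simp add: s_def a_def b_def \<tau>_def mult_ac)
  note lin = metric_form_linear christoffel_map_linear christoffel_map_deriv_linear christoffel_map_minus
    D\<Gamma>_scale_direction[OF x]
  have Kd: "K_deriv (P u) (P_deriv u v) (P_deriv u w) = (\<tau> * v $ 1 * w $ 1) *\<^sub>R (D\<Gamma> x (c' s) (\<epsilon> s) (c' s) + \<Gamma> x (\<epsilon>' s) (c' s))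
      - (a * w $ 1) *\<^sub>R \<epsilon>' s"
    "K_deriv (P u) (P_deriv u w) (P_deriv u v) = (\<tau> * v $ 1 * w $ 1) *\<^sub>R (D\<Gamma> x (c' s) (\<epsilon> s) (c' s) + \<Gamma> x (\<epsilon>' s) (c' s))
      - (b * v $ 1) *\<^sub>R \<epsilon>' s"
    "K_deriv (P u) (P_deriv u v) \<nu> = (\<tau> * v $ 1) *\<^sub>R (D\<Gamma> x (c' s) (\<epsilon> s) n1 + \<Gamma> x (\<epsilon>' s) n1) + a *\<^sub>R \<Gamma> x (\<epsilon> s) n1"
    "K_deriv (P u) (P_deriv u w) \<nu> = (\<tau> * w $ 1) *\<^sub>R (D\<Gamma> x (c' s) (\<epsilon> s) n1 + \<Gamma> x (\<epsilon>' s) n1) + b *\<^sub>R \<Gamma> x (\<epsilon> s) n1"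
    "K_deriv (P u) \<nu> (P_deriv u v) = v $ 1 *\<^sub>R (\<tau> *\<^sub>R D\<Gamma> x n1 (\<epsilon> s) (c' s) + \<Gamma> x n2 (c' s))"
    "K_deriv (P u) \<nu> (P_deriv u w) = w $ 1 *\<^sub>R (\<tau> *\<^sub>R D\<Gamma> x n1 (\<epsilon> s) (c' s) + \<Gamma> x n2 (c' s))"
    by (simp_all add: K_deriv_def z parts lin par n1_def n2_def algebra_simps)
  have Dg: "metric_form (Dg x (c' s)) (c' s) n1 = metric_form (g x) (\<Gamma> x (c' s) (c' s)) n1 + metric_form (g x) (c' s) (\<Gamma> x n1 (c' s))"
    "metric_form (Dg x n1) (c' s) (c' s) = 2 * metric_form (g x) (c' s) (\<Gamma> x n1 (c' s))"
    "metric_form (Dg x (c' s)) (\<epsilon> s) N = - metric_form (g x) (\<epsilon>' s) N + metric_form (g x) (\<epsilon> s) (\<Gamma> x n2 (c' s))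
       + \<tau> * metric_form (g x) (\<epsilon> s) (\<Gamma> x (\<Gamma> x (\<epsilon> s) n1) (c' s))"
    "metric_form (Dg x n1) (\<epsilon> s) (\<epsilon> s) = 2 * metric_form (g x) (\<epsilon> s) (\<Gamma> x (\<epsilon> s) n1)"
    using \<Gamma>_commute[OF x, of "c' s" n1] commute[OF x]
    by (simp_all add: Dg_eq_\<Gamma>[OF x] par lin N right_diff_distrib)
  have curv: "metric_form (g x) (\<epsilon> s) (D\<Gamma> x n1 (\<epsilon> s) (c' s)) = metric_form (g x) (\<epsilon> s) (D\<Gamma> x (c' s) (\<epsilon> s) n1)
      + metric_form (g x) (\<epsilon> s) (\<Gamma> x (\<Gamma> x (\<epsilon> s) n1) (c' s)) + metric_form (g x) (\<epsilon> s) (\<Gamma> x (\<epsilon>' s) n1)"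
    using curvature_skew[OF x, of "\<epsilon> s" "c' s" n1] by (simp add: par lin)
  have b2: "base_part (P_deriv2 u v w) = (v $ 1 * w $ 1) *\<^sub>R c'' s" by (simp add: P_deriv2_def s_def)
  (* the three derivatives of the Sasaki metric that make up its Christoffel symbol of the first kind *)
  note comm = commute[OF x, of _ "\<epsilon> s"]
  have 1: "G_deriv (P u) (P_deriv u v) (P_deriv u w) \<nu>
     = v $ 1 * w $ 1 * metric_form (Dg x (c' s)) (c' s) n1 + v $ 1 * b * metric_form (Dg x (c' s)) (\<epsilon> s) N
     + metric_form (g x) (K_deriv (P u) (P_deriv u v) (P_deriv u w)) N + b * metric_form (g x) (\<epsilon> s) (K_deriv (P u) (P_deriv u v) \<nu>)"
    "G_deriv (P u) (P_deriv u w) (P_deriv u v) \<nu>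
     = v $ 1 * w $ 1 * metric_form (Dg x (c' s)) (c' s) n1 + w $ 1 * a * metric_form (Dg x (c' s)) (\<epsilon> s) N
     + metric_form (g x) (K_deriv (P u) (P_deriv u w) (P_deriv u v)) N + a * metric_form (g x) (\<epsilon> s) (K_deriv (P u) (P_deriv u w) \<nu>)"
    "G_deriv (P u) \<nu> (P_deriv u v) (P_deriv u w)
     = v $ 1 * w $ 1 * metric_form (Dg x n1) (c' s) (c' s) + a * b * metric_form (Dg x n1) (\<epsilon> s) (\<epsilon> s)
     + b * metric_form (g x) (\<epsilon> s) (K_deriv (P u) \<nu> (P_deriv u v)) + a * metric_form (g x) (\<epsilon> s) (K_deriv (P u) \<nu> (P_deriv u w))"
    unfolding G_deriv_def
    by (simp_all add: z parts K n1_def[symmetric] N_def[symmetric] linear_scale[OF Dg_linear[OF x]] metric_form_scaleR comm)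
  have "metric_form (G (P u)) (P_deriv2 u v w) \<nu>
     = v $ 1 * w $ 1 * metric_form (g x) (c'' s) n1 + metric_form (g x) (K (P u) (P_deriv2 u v w)) N"
    by (simp add: metric_form_G sasaki_form_def z b2 n1_def N_def metric_form_scaleR)
  then have "metric_form (G (P u)) (P_deriv2 u v w + christoffel_map G (P u) (P_deriv u v) (P_deriv u w)) \<nu>
     = \<beta> u v w * metric_form (g x) (\<epsilon> s) N"
    unfolding metric_form_add lowered_christoffel_G[OF P_in[OF u]] 1 Kd K2 par' Dg
    by (simp add: metric_form_linear curv geo) (simp add: field_simps)
  then show ?thesis by (simp add: N_def x_def s_def)
qed

lemma G_P_deriv:
  assumes u: "u $ 1 \<in> T"
  shows "metric_form (G (P u)) (P_deriv u v) (P_deriv u w)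
    = metric_form (g (c (u $ 1))) (c' (u $ 1)) (c' (u $ 1)) * v $ 1 * w $ 1 + \<alpha> u v * \<alpha> u w"
  using unit[OF u]
  by (simp add: metric_form_G sasaki_form_def K_P_deriv[OF u] P_parts metric_form_scaleR)
    (simp add: P_deriv_def metric_form_scaleR)

end

section \<open>The induced metric of the cylinder\<close>

lemma open_first_coordinate: "open T \<Longrightarrow> open {u::real^2. u $ 1 \<in> T}"
  using open_vimage_vec_nth[of T 1] by (simp add: vimage_def)

lemma pd_eqI: "(f has_derivative f') (at x) \<Longrightarrow> pd i f x = f' (axis i 1)"
  unfolding pd_def using frechet_derivative_at by metis

lemma christoffel_map_axis: "christoffel_map G x (axis i 1) (axis j 1) $ k = christoffel G x k i j"
proof -
  have "christoffel_map G x (axis i 1) (axis j 1) $ k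
    = (\<Sum>i'\<in>UNIV. \<Sum>j'\<in>UNIV. if j' = j then if i' = i then christoffel G x k i' j' else 0 else 0)"
    unfolding christoffel_map_def vec_lambda_beta by (intro sum.cong) (simp_all add: axis_def)
  also have "\<dots> = christoffel G x k i j" by simp
  finally show ?thesis .
qed

context cylinder_chart
begin

text \<open>On \<open>T\<close> the first fundamental form is \<open>\<kappa>(s) ds\<^sup>2 + dy\<^sup>2\<close> with \<open>y = t \<rho>(s)\<close>, and
  \<open>\<alpha>\<close> is the form \<open>dy\<close>. Where \<open>\<kappa>\<close> and \<open>\<rho>\<close> do not vanish it is flat, since the vector
  \<open>\<Gamma>\<^sub>2\<^sub>2\<close> is zero and \<open>\<Gamma>\<^sub>1\<^sub>2\<close> is a multiple of the second coordinate vector by a function of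
  \<open>s\<close> alone.\<close>

definition first_form :: "real^2 \<Rightarrow> real^2^2" where
  "first_form u = (\<chi> a b. metric_form (G (P u))
     (frechet_derivative P (at u) (axis a 1)) (frechet_derivative P (at u) (axis b 1)))"

definition \<kappa> :: "real \<Rightarrow> real" where
  "\<kappa> s = metric_form (g (c s)) (c' s) (c' s)"

lemma \<alpha>_axis: "\<alpha> u (axis 2 1) = \<rho> (u $ 1)" "\<beta> u v (axis 2 1) = \<rho>' (u $ 1) * v $ 1"
  by (simp_all add: \<alpha>_def \<beta>_def axis_def)

lemma metric_form_first_form:
  assumes "u $ 1 \<in> T"
  shows "metric_form (first_form u) v w = \<kappa> (u $ 1) * v $ 1 * w $ 1 + \<alpha> u v * \<alpha> u w"
proof -
  have "first_form u = (\<chi> a b. \<kappa> (u $ 1) * axis a 1 $ 1 * axis b 1 $ 1 + \<alpha> u (axis a 1) * \<alpha> u (axis b 1))"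
    by (simp add: first_form_def frechet_derivative_at[OF has_derivative_P[OF assms], symmetric]
        G_P_deriv[OF assms] \<kappa>_def)
  then show ?thesis
    unfolding metric_form_sum_entries[of "first_form u"]
    by (simp add: sum_2 axis_def \<alpha>_def algebra_simps)
qed

text \<open>After lowering the index, the two vectors become the forms \<open>0\<close> and \<open>\<rho>' dy\<close>,
  and \<open>\<rho> dy\<close> is the form metrically dual to the second coordinate vector.\<close>

lemma christoffel_first_form:
  assumes u: "u $ 1 \<in> T" and c'_nz: "c' (u $ 1) \<noteq> 0" and \<rho>_nz: "\<rho> (u $ 1) \<noteq> 0"
  shows "christoffel_map first_form u (axis 2 1) (axis 2 1) = 0"
    and "christoffel_map first_form u (axis 1 1) (axis 2 1) = (\<rho>' (u $ 1) / \<rho> (u $ 1)) *\<^sub>R axis 2 1"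
proof -
  have \<kappa>: "\<kappa> (u $ 1) > 0" unfolding \<kappa>_def by (intro positive c_in u c'_nz)
  obtain k where k: "((\<lambda>r. \<kappa> (r $ 1)) has_derivative k) (at u)" "k (axis 2 1) = 0"
  proof -
    have "((\<lambda>s. g (c s)) has_derivative (\<lambda>h. Dg (c (u $ 1)) (h *\<^sub>R c' (u $ 1)))) (at (u $ 1))"
      by (rule has_derivative_compose[of c "\<lambda>h. h *\<^sub>R c' (u $ 1)", OF _ has_derivative_metric[OF c_in[OF u]]])
        (use c[OF u] in \<open>simp add: has_vector_derivative_def\<close>)
    from has_derivative_metric_form[OF this c'[OF u, unfolded has_vector_derivative_def] c'[OF u, unfolded has_vector_derivative_def]]
    obtain l where l: "(\<kappa> has_derivative l) (at (u $ 1))" unfolding \<kappa>_def[abs_def] by blast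
    from has_derivative_compose[OF bounded_linear_imp_has_derivative[OF bounded_linear_vec_nth] l]
    have "((\<lambda>r. \<kappa> (r $ 1)) has_derivative (\<lambda>v. l (v $ 1))) (at u)" .
    moreover have "l (axis 2 (1::real) $ (1::2)) = 0"
      using linear_0[OF has_derivative_linear[OF l]] by (simp add: axis_def)
    ultimately show ?thesis by (rule that)
  qed
  define B where "B a v w = k a * v $ 1 * w $ 1 + \<beta> u a v * \<alpha> u w + \<alpha> u v * \<beta> u a w" for a v w
  have "((\<lambda>r. metric_form (first_form r) v w) has_derivative (\<lambda>a. B a v w)) (at u)" for v w
  proof (rule has_derivative_transform_within_open)
    show "open {r::real^2. r $ 1 \<in> T}"
      by (rule open_first_coordinate[OF open_params])
    show "((\<lambda>r. \<kappa> (r $ 1) * v $ 1 * w $ 1 + \<alpha> r v * \<alpha> r w) has_derivative (\<lambda>a. B a v w)) (at u)"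
      by (rule has_derivative_eq_rhs[OF has_derivative_add[OF
            has_derivative_mult_left[OF has_derivative_mult_left[OF k(1)]]
            has_derivative_mult[OF has_derivative_\<alpha>[OF u] has_derivative_\<alpha>[OF u]]]])
        (auto simp: B_def)
  qed (use u metric_form_first_form in auto)
  then obtain G' where G': "(first_form has_derivative G') (at u)" "\<And>a v w. metric_form (G' a) v w = B a v w"
    using has_derivative_metricE by metis
  have sym: "transpose (first_form u) = first_form u"
    unfolding transpose_def vec_eq_iff
    by (simp add: metric_form_axis[symmetric] metric_form_first_form[OF u] mult_ac)
  have square: "x * x > 0" if "x \<noteq> 0" for x :: real
    using that not_real_square_gt_zero by blast
  have pos: "metric_form (first_form u) v v > 0" if "v \<noteq> 0" for v
  proof (cases "v $ 1 = 0")
    case True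
    then have "v $ 2 * \<rho> (u $ 1) \<noteq> 0" using that \<rho>_nz by (auto simp: vec_eq_iff forall_2)
    from square[OF this] show ?thesis
      using True by (simp add: metric_form_first_form[OF u] \<alpha>_def)
  next
    case False
    from mult_pos_pos[OF \<kappa> square[OF this]] show ?thesis
      by (simp add: metric_form_first_form[OF u] mult.assoc add_pos_nonneg)
  qed
  have inv: "invertible (first_form u)" by (intro invertible_if_positive_definite pos)
  have eqI: "x = y" if "\<And>z. metric_form (first_form u) x z = metric_form (first_form u) y z" for x y
    using pos that by (rule positive_definite_nondegenerate)
  note lowered = metric_form_christoffel_map[OF G'(1) sym inv, unfolded G'(2)]
  show "christoffel_map first_form u (axis 2 1) (axis 2 1) = 0"
    by (rule eqI) (simp add: lowered B_def k(2) \<alpha>_axis, simp add: \<alpha>_def \<beta>_def axis_def)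
  show "christoffel_map first_form u (axis 1 1) (axis 2 1) = (\<rho>' (u $ 1) / \<rho> (u $ 1)) *\<^sub>R axis 2 1"
  proof (rule eqI)
    fix z
    have "metric_form (first_form u) (christoffel_map first_form u (axis 1 1) (axis 2 1)) z = \<rho>' (u $ 1) * \<alpha> u z"
      unfolding lowered B_def k(2) \<alpha>_axis by (simp add: \<alpha>_def \<beta>_def axis_def field_simps)
    also have "\<dots> = metric_form (first_form u) ((\<rho>' (u $ 1) / \<rho> (u $ 1)) *\<^sub>R axis 2 1) z"
      unfolding metric_form_scaleR metric_form_first_form[OF u] \<alpha>_axis using \<rho>_nz by (simp add: axis_def)
    finally show "metric_form (first_form u) (christoffel_map first_form u (axis 1 1) (axis 2 1)) z
      = metric_form (first_form u) ((\<rho>' (u $ 1) / \<rho> (u $ 1)) *\<^sub>R axis 2 1) z" .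
  qed
qed

lemma gaussian_curvature_first_form:
  assumes u: "u $ 1 \<in> T" and "c' (u $ 1) \<noteq> 0" "\<rho> (u $ 1) \<noteq> 0"
  shows "gaussian_curvature first_form u = 0"
proof -
  define S where "S = {s \<in> T. c' s \<noteq> 0 \<and> \<rho> s \<noteq> 0}"
  have "continuous_on T c'" "continuous_on T \<rho>"
    using c' \<rho> by (auto intro!: continuous_at_imp_continuous_on has_vector_derivative_continuous)
  then have "open (T \<inter> c' -` (- {0}))" "open (T \<inter> \<rho> -` (- {0}))"
    using open_params by (auto intro: continuous_open_preimage)
  then have "open ((T \<inter> c' -` (- {0})) \<inter> (T \<inter> \<rho> -` (- {0})))" by (rule open_Int)
  also have "(T \<inter> c' -` (- {0})) \<inter> (T \<inter> \<rho> -` (- {0})) = S" by (auto simp: S_def)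
  finally have "open S" .
  then have W: "open {r::real^2. r $ 1 \<in> S}"
    by (rule open_first_coordinate)
  have uW: "u \<in> {r. r $ 1 \<in> S}" using assms by (simp add: S_def)
  have \<Gamma>22: "christoffel first_form r l 2 2 = 0"
    and \<Gamma>12: "christoffel first_form r l 1 2 = (if l = 2 then \<rho>' (r $ 1) / \<rho> (r $ 1) else 0)"
    if "r \<in> {r. r $ 1 \<in> S}" for r l
    using that christoffel_first_form[of r]
    by (auto simp: S_def christoffel_map_axis[symmetric] axis_def)
  have "pd 1 (\<lambda>y. christoffel first_form y l 2 2) u = 0" for l
  proof -
    have "((\<lambda>y. christoffel first_form y l 2 2) has_derivative (\<lambda>h. 0)) (at u)"
      using \<Gamma>22 by (intro has_derivative_transform_within_open[OF has_derivative_const W uW]) simp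
    then show ?thesis by (rule pd_eqI)
  qed
  moreover have "pd 2 (\<lambda>y. christoffel first_form y l 1 2) u = 0" for l
  proof (cases "l = 2")
    case True
    have "((\<lambda>y. \<rho>' (y $ 1) / \<rho> (y $ 1)) has_derivative
        (\<lambda>h. - \<rho>' (u $ 1) * (inverse (\<rho> (u $ 1)) * (h $ 1 *\<^sub>R \<rho>' (u $ 1)) * inverse (\<rho> (u $ 1)))
          + (h $ 1 *\<^sub>R \<rho>'' (u $ 1)) / \<rho> (u $ 1))) (at u)"
      using has_derivative_divide[OF has_derivative_\<rho>'[OF u] has_derivative_\<rho>[OF u]] assms by simp
    then have "((\<lambda>y. christoffel first_form y l 1 2) has_derivative
        (\<lambda>h. - \<rho>' (u $ 1) * (inverse (\<rho> (u $ 1)) * (h $ 1 *\<^sub>R \<rho>' (u $ 1)) * inverse (\<rho> (u $ 1)))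
          + (h $ 1 *\<^sub>R \<rho>'' (u $ 1)) / \<rho> (u $ 1))) (at u)"
      using \<Gamma>12 True by (elim has_derivative_transform_within_open[OF _ W uW]) simp
    from pd_eqI[OF this, of 2] show ?thesis by (simp add: axis_def)
  next
    case False
    then have "((\<lambda>y. christoffel first_form y l 1 2) has_derivative (\<lambda>h. 0)) (at u)"
      using \<Gamma>12 by (intro has_derivative_transform_within_open[OF has_derivative_const W uW]) simp
    then show ?thesis by (rule pd_eqI)
  qed
  ultimately have "riemann first_form u l 2 1 2 = 0" for l
    using uW by (simp add: riemann_def sum_2 \<Gamma>22 \<Gamma>12)
  then show ?thesis by (simp add: gaussian_curvature_def)
qed

text \<open>At a regular point neither factor degenerates: if \<open>\<rho> = 0\<close> the second coordinate vector is
  mapped to \<open>0\<close>, and if \<open>c' = 0\<close> then \<open>\<epsilon>' = 0\<close> as well and the image is spanned by the vertical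
  lift of \<open>\<epsilon>\<close>.\<close>

lemma inj_P_derivD:
  assumes u: "u $ 1 \<in> T" and inj: "inj (P_deriv u)"
  shows "\<rho> (u $ 1) \<noteq> 0" and "c' (u $ 1) \<noteq> 0"
proof -
  have nz: "v = 0" if "P_deriv u v = join 0 0" for v
    using injD[OF inj, of v 0] that by (simp add: P_deriv_def \<alpha>_def)
  show \<rho>0: "\<rho> (u $ 1) \<noteq> 0"
  proof
    assume "\<rho> (u $ 1) = 0"
    then have "axis 2 1 = (0::real^2)" by (intro nz) (simp add: P_deriv_def \<alpha>_axis, simp add: axis_def)
    then show False by (simp add: axis_eq_0_iff)
  qed
  show "c' (u $ 1) \<noteq> 0"
  proof
    assume 0: "c' (u $ 1) = 0"
    then have "\<epsilon>' (u $ 1) = 0" using parallel[OF u] by simp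
    (* this vector is annihilated by the form dy *)
    with 0 have "vector [\<rho> (u $ 1), - (u $ 2 * \<rho>' (u $ 1))] = (0::real^2)"
      by (intro nz) (simp add: P_deriv_def \<alpha>_def)
    then have "\<rho> (u $ 1) = 0" by (simp add: vec_eq_iff forall_2)
    with \<rho>0 show False by simp
  qed
qed

end

section \<open>Smoothness of the cylinder\<close>

lemma smooth_on_has_vector_derivative:
  assumes "smooth_on T f" "s \<in> T"
  shows "(f has_vector_derivative frechet_derivative f (at s) 1) (at s)"
proof -
  have "Ck_on 1 T f" using assms by (simp add: smooth_on_def)
  then have D: "(f has_derivative frechet_derivative f (at s)) (at s)"
    using assms(2) by (simp add: frechet_derivative_works[symmetric])
  have "frechet_derivative f (at s) h = h *\<^sub>R frechet_derivative f (at s) 1" for h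
    using linear_scale[OF has_derivative_linear[OF D], of h 1] by simp
  then show ?thesis unfolding has_vector_derivative_def using D by (metis (no_types, lifting) ext)
qed

lemma smooth_on_frechet_derivative: "smooth_on T f \<Longrightarrow> smooth_on T (\<lambda>s. frechet_derivative f (at s) v)"
proof -
  assume f: "smooth_on T f"
  show ?thesis
    unfolding smooth_on_def
  proof
    fix k
    from f have "Ck_on (Suc k) T f" unfolding smooth_on_def ..
    then show "Ck_on k T (\<lambda>s. frechet_derivative f (at s) v)" by simp
  qed
qed

text \<open>Tangent vectors are families of components related by the derivatives of the transition maps,
  which are linear because an atlas is smooth.\<close>

lemma tangent_space_scaleR:
  assumes M: "riemannian_manifold M" and \<xi>: "\<xi> \<in> tangent_space M q"
  shows "(\<lambda>i. r *\<^sub>R \<xi> i) \<in> tangent_space M q"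
proof -
  have lin: "frechet_derivative (transition M i j) (at (chart_map M i q)) (r *\<^sub>R v)
      = r *\<^sub>R frechet_derivative (transition M i j) (at (chart_map M i q)) v"
    if "i \<in> charts M" "j \<in> charts M" "q \<in> chart_dom M i \<inter> chart_dom M j" for i j v
  proof -
    have "smooth_on (chart_map M i ` (chart_dom M i \<inter> chart_dom M j)) (transition M i j)"
      using M that unfolding riemannian_manifold_def smooth_atlas_def by blast
    then have "Ck_on 1 (chart_map M i ` (chart_dom M i \<inter> chart_dom M j)) (transition M i j)"
      by (simp add: smooth_on_def)
    then have "(transition M i j has_derivative frechet_derivative (transition M i j) (at (chart_map M i q))) (at (chart_map M i q))"
      using that by (simp add: frechet_derivative_works[symmetric])
    from linear_scale[OF has_derivative_linear[OF this]] show ?thesis .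
  qed
  have "r *\<^sub>R \<xi> j = frechet_derivative (transition M i j) (at (chart_map M i q)) (r *\<^sub>R \<xi> i)"
    if "i \<in> charts M" "j \<in> charts M" "q \<in> chart_dom M i \<inter> chart_dom M j" for i j
  proof -
    have "\<xi> j = frechet_derivative (transition M i j) (at (chart_map M i q)) (\<xi> i)"
      using \<xi> that unfolding tangent_space_def by blast
    then show ?thesis using lin[OF that, of "\<xi> i"] by argo
  qed
  moreover have "(i \<in> charts M \<and> q \<in> chart_dom M i) \<or> r *\<^sub>R \<xi> i = 0" for i
    using \<xi> unfolding tangent_space_def by auto
  ultimately show ?thesis unfolding tangent_space_def by blast
qed

lemma chart_map_cylinder:
  "chart_map (tangent_bundle M) i \<circ> cylinder \<gamma> \<rho> e
    = (\<lambda>u. join ((chart_map M i \<circ> \<gamma>) (u $ 1)) ((u $ 2 * \<rho> (u $ 1)) *\<^sub>R e (u $ 1) i))"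
  by (auto simp: tangent_bundle_def cylinder_def)

lemma cylinder_mem_chart_dom:
  assumes "riemannian_manifold M" "vector_field_along M D \<gamma> e" "u $ 1 \<in> D"
  shows "cylinder \<gamma> \<rho> e u \<in> chart_dom (tangent_bundle M) i \<longleftrightarrow> \<gamma> (u $ 1) \<in> chart_dom M i"
  using assms tangent_space_scaleR[OF assms(1)]
  by (auto simp: tangent_bundle_def cylinder_def vector_field_along_def)

lemma smooth_map_cylinder:
  assumes M: "riemannian_manifold M" and \<gamma>: "smooth_map M D \<gamma>"
    and e: "vector_field_along M D \<gamma> e" and \<rho>: "smooth_on D \<rho>"
  shows "smooth_map (tangent_bundle M) {u. u $ 1 \<in> D} (cylinder \<gamma> \<rho> e)"
  unfolding smooth_map_def
proof (intro conjI ballI)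
  note dom = cylinder_mem_chart_dom[OF M e]
  show "cylinder \<gamma> \<rho> e ` {u. u $ 1 \<in> D} \<subseteq> points (tangent_bundle M)"
  proof (rule image_subsetI)
    fix u :: "real^2" assume "u \<in> {u. u $ 1 \<in> D}"
    then have u: "u $ 1 \<in> D" by simp
    then obtain i where "i \<in> charts M" "\<gamma> (u $ 1) \<in> chart_dom M i"
      using \<gamma> by (auto simp: smooth_map_def points_def)
    then show "cylinder \<gamma> \<rho> e u \<in> points (tangent_bundle M)"
      unfolding points_def using dom[OF u, of \<rho> i] by (intro UN_I[of i]) (simp_all add: tangent_bundle_def)
  qed
  fix i assume "i \<in> charts (tangent_bundle M)"
  then have i: "i \<in> charts M" by (simp add: tangent_bundle_def)
  define T where "T = {s \<in> D. \<gamma> s \<in> chart_dom M i}"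
  have T: "open T" and c: "smooth_on T (chart_map M i \<circ> \<gamma>)"
    using \<gamma> i by (auto simp: smooth_map_def T_def)
  have \<epsilon>: "smooth_on T (\<lambda>s. e s i)" using e i by (simp add: vector_field_along_def T_def)
  have eq: "{u \<in> {u. u $ 1 \<in> D}. cylinder \<gamma> \<rho> e u \<in> chart_dom (tangent_bundle M) i} = (\<lambda>u. u $ 1) -` T"
    using dom by (auto simp: T_def)
  have W: "open ((\<lambda>u::real^2. u $ 1) -` T)" using T by (rule open_vimage_vec_nth)
  show "open {u \<in> {u. u $ 1 \<in> D}. cylinder \<gamma> \<rho> e u \<in> chart_dom (tangent_bundle M) i}"
    unfolding eq by (rule W)
  have lift: "Ck_on k ((\<lambda>u::real^2. u $ 1) -` T) (\<lambda>u. f (u $ 1))" if "smooth_on T f" for k and f :: "real \<Rightarrow> 'x::real_normed_vector"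
    using that by (intro Ck_on_compose_linear T bounded_linear_vec_nth) (simp add: smooth_on_def)
  have \<rho>T: "smooth_on T \<rho>"
    using \<rho> by (auto simp: smooth_on_def T_def intro: Ck_on_subset)
  have j1: "bounded_linear (\<lambda>x. join x 0)" and j2: "bounded_linear (\<lambda>\<xi>. join 0 \<xi>)"
    unfolding linear_conv_bounded_linear[symmetric]
    by (auto simp: join_def vec_eq_iff split: sum.split intro!: linearI)
  have "Ck_on k ((\<lambda>u::real^2. u $ 1) -` T) (\<lambda>u. join ((chart_map M i \<circ> \<gamma>) (u $ 1)) 0
      + join 0 ((u $ 2 * \<rho> (u $ 1)) *\<^sub>R e (u $ 1) i))" for k
    by (intro Ck_on_add[OF W] bounded_linear.Ck_on[OF j1 W] bounded_linear.Ck_on[OF j2 W]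
        bounded_bilinear.Ck_on[OF bounded_bilinear_scaleR W] bounded_bilinear.Ck_on[OF bounded_bilinear_mult W]
        Ck_on_bounded_linear[OF W bounded_linear_vec_nth] lift[OF c] lift[OF \<epsilon>] lift[OF \<rho>T])
  moreover have "join x 0 + join 0 \<xi> = join x \<xi>" for x \<xi> :: "real^'c"
    by (auto simp: join_def vec_eq_iff split: sum.split)
  ultimately show "smooth_on {u \<in> {u. u $ 1 \<in> D}. cylinder \<gamma> \<rho> e u \<in> chart_dom (tangent_bundle M) i}
      (chart_map (tangent_bundle M) i \<circ> cylinder \<gamma> \<rho> e)"
    unfolding eq chart_map_cylinder smooth_on_def by simp
qed

section \<open>The cylinder is totally geodesic and flat\<close>

text \<open>The operators \<open>d\<close> and \<open>d'\<close> are the same derivative, for vector-valued and for real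
  functions; as local abbreviations they have one fixed type each.\<close>

lemma cylinder_chartI:
  assumes M: "riemannian_manifold M" and i: "i \<in> charts M"
    and \<gamma>: "geodesic M D \<gamma>" and e: "vector_field_along M D \<gamma> e" "unit_along M D \<gamma> e" "parallel_along M D \<gamma> e"
    and \<rho>: "smooth_on D \<rho>"
  defines "T \<equiv> {s \<in> D. \<gamma> s \<in> chart_dom M i}" and "c \<equiv> chart_map M i \<circ> \<gamma>" and "\<epsilon> \<equiv> \<lambda>s. e s i"
    and "d \<equiv> \<lambda>f s. frechet_derivative f (at s) 1" and "d' \<equiv> \<lambda>f s. frechet_derivative f (at s) 1"
  shows "cylinder_chart M i (chart_map M i ` chart_dom M i) T c (d c) (d (d c)) \<epsilon> (d \<epsilon>) (d (d \<epsilon>)) \<rho> (d' \<rho>) (d' (d' \<rho>))"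
proof -
  let ?U = "chart_map M i ` chart_dom M i"
  have "open (chart_map M i ` (chart_dom M i \<inter> chart_dom M i))"
    using M i by (simp only: riemannian_manifold_def smooth_atlas_def)
  moreover have "Ck_on 2 ?U (metric M i)"
    using M i by (simp add: riemannian_manifold_def smooth_on_def)
  moreover have "\<forall>x\<in>?U. transpose (metric M i x) = metric M i x \<and> (\<forall>v. v \<noteq> 0 \<longrightarrow> metric_form (metric M i x) v v > 0)"
    using M i unfolding riemannian_manifold_def by blast
  ultimately interpret bundle_chart M i ?U
    by unfold_locales auto
  have T: "open T" and c: "smooth_on T c"
    using \<gamma> i by (auto simp: geodesic_def smooth_map_def T_def c_def)
  have \<epsilon>: "smooth_on T \<epsilon>" using e i by (simp add: vector_field_along_def T_def \<epsilon>_def)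
  have \<rho>T: "smooth_on T \<rho>"
    using \<rho> by (auto simp: smooth_on_def T_def intro: Ck_on_subset)
  have in_U: "c s \<in> ?U" if "s \<in> T" for s using that by (auto simp: T_def c_def)
  show ?thesis
  proof
    fix s assume s: "s \<in> T"
    have "cov_deriv M i \<gamma> (\<lambda>r. tangent_map M i \<gamma> r 1) s 1 = 0"
      using \<gamma> i s by (simp add: geodesic_def T_def)
    then show "d (d c) s = - \<Gamma> (c s) (d c s) (d c s)"
      by (simp add: cov_deriv_def tangent_map_def c_def d_def eq_neg_iff_add_eq_0)
    have "cov_deriv M i \<gamma> \<epsilon> s 1 = 0"
      using e i s by (simp add: parallel_along_def T_def \<epsilon>_def)
    then have "d \<epsilon> s + \<Gamma> (c s) (d c s) (\<epsilon> s) = 0"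
      by (simp add: cov_deriv_def tangent_map_def c_def d_def)
    then show "\<Gamma> (c s) (\<epsilon> s) (d c s) = - d \<epsilon> s"
      using \<Gamma>_commute[OF in_U[OF s]] by (simp add: eq_neg_iff_add_eq_0 add.commute)
    show "metric_form (metric M i (c s)) (\<epsilon> s) (\<epsilon> s) = 1"
      using e i s by (simp add: unit_along_def T_def \<epsilon>_def c_def)
  qed (use T in_U in \<open>auto simp: d_def d'_def intro!: smooth_on_has_vector_derivative smooth_on_frechet_derivative c \<epsilon> \<rho>T\<close>)
qed

text \<open>By \<open>cov_deriv_P\<close> the second fundamental form is \<open>\<beta>\<close> times the product of \<open>\<nu>\<close> with
  the vertical lift of \<open>\<epsilon>\<close>. At a regular point \<open>\<rho> \<noteq> 0\<close>, so that lift is a multiple of the tangent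
  vector \<open>\<partial>\<^sub>t P\<close> and orthogonal to \<open>\<nu>\<close>.\<close>

lemma cylinder_totally_geodesic_flat_at:
  assumes cyl: "cylinder_chart M i U T (chart_map M i \<circ> \<gamma>) c' c'' (\<lambda>s. e s i) \<epsilon>' \<epsilon>'' \<rho> \<rho>' \<rho>''"
    and u: "u $ 1 \<in> T" and inj: "inj (tangent_map (tangent_bundle M) i (cylinder \<gamma> \<rho> e) u)"
  shows "\<nu> \<in> normal_space (tangent_bundle M) i (cylinder \<gamma> \<rho> e) u \<Longrightarrow>
      second_fundamental_form (tangent_bundle M) i (cylinder \<gamma> \<rho> e) u \<nu> v w = 0"
    and "gaussian_curvature (induced_metric (tangent_bundle M) i (cylinder \<gamma> \<rho> e)) u = 0"
proof -
  interpret cylinder_chart M i U T "chart_map M i \<circ> \<gamma>" c' c'' "\<lambda>s. e s i" \<epsilon>' \<epsilon>'' \<rho> \<rho>' \<rho>'' by fact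
  let ?F = "cylinder \<gamma> \<rho> e" and ?TM = "tangent_bundle M"
  have F: "chart_map ?TM i \<circ> ?F = P" unfolding chart_map_cylinder P_def[abs_def] ..
  then have F': "chart_map ?TM i (?F r) = P r" for r by (metis comp_apply)
  have tan: "tangent_map ?TM i ?F r = P_deriv r" if "r $ 1 \<in> T" for r
    using frechet_derivative_at[OF has_derivative_P[OF that]] by (auto simp: tangent_map_def F)
  note W = open_first_coordinate[OF open_params]
  have tan2: "frechet_derivative (\<lambda>r. tangent_map ?TM i ?F r w) (at u) v = P_deriv2 u v w" for v w
  proof -
    have "((\<lambda>r. tangent_map ?TM i ?F r w) has_derivative (\<lambda>v. P_deriv2 u v w)) (at u)"
      by (rule has_derivative_transform_within_open[OF has_derivative_P_deriv[OF u] W]) (simp_all add: u tan)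
    from fun_cong[OF frechet_derivative_at[OF this], of v] show ?thesis ..
  qed
  have reg: "\<rho> (u $ 1) \<noteq> 0" "c' (u $ 1) \<noteq> 0" using inj_P_derivD[OF u] inj tan[OF u] by auto
  show "second_fundamental_form ?TM i ?F u \<nu> v w = 0" if "\<nu> \<in> normal_space ?TM i ?F u"
  proof -
    let ?x = "(chart_map M i \<circ> \<gamma>) (u $ 1)"
    have "metric_form (G (P u)) (P_deriv u (axis 2 1)) \<nu> = 0"
      using that tan[OF u] by (simp add: normal_space_def F')
    then have "\<rho> (u $ 1) * metric_form (g ?x) (e (u $ 1) i) (K (P u) \<nu>) = 0"
      by (simp add: metric_form_G sasaki_form_def K_P_deriv[OF u] P_parts \<alpha>_axis metric_form_scaleR)
        (simp add: P_deriv_def axis_def)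
    then have "metric_form (g ?x) (e (u $ 1) i) (K (P u) \<nu>) = 0" using reg by simp
    then show ?thesis
      unfolding second_fundamental_form_def cov_deriv_def F' tan2 tan[OF u] cov_deriv_P[OF u] by simp
  qed
  have "induced_metric ?TM i ?F = first_form"
    by (simp add: fun_eq_iff induced_metric_def first_form_def tangent_map_def F F')
  then show "gaussian_curvature (induced_metric ?TM i ?F) u = 0"
    using gaussian_curvature_first_form[OF u] reg by simp
qed

theorem proposition2p4:
  fixes M :: "('i, 'a, 'n::finite) riemannian"
    and D :: "real set"
    and \<gamma> :: "real \<Rightarrow> 'a"
    and \<rho> :: "real \<Rightarrow> real"
    and e :: "real \<Rightarrow> 'i \<Rightarrow> real^'n"
  assumes "riemannian_manifold M"
    and "open D" "is_interval D"
    and "geodesic M D \<gamma>"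
    and "vector_field_along M D \<gamma> e"
    and "unit_along M D \<gamma> e"
    and "parallel_along M D \<gamma> e"
    and "smooth_on D \<rho>"
  shows "totally_geodesic_surface (tangent_bundle M) {u. u $ 1 \<in> D} (cylinder \<gamma> \<rho> e)
       \<and> intrinsically_flat_surface (tangent_bundle M) {u. u $ 1 \<in> D} (cylinder \<gamma> \<rho> e)"
proof -
  let ?TM = "tangent_bundle M" and ?F = "cylinder \<gamma> \<rho> e" and ?D = "{u :: real^2. u $ 1 \<in> D}"
  have smooth: "smooth_map ?TM ?D ?F"
    using assms by (intro smooth_map_cylinder) (auto simp: geodesic_def)
  have "second_fundamental_form ?TM i ?F u \<nu> v w = 0 \<or> \<nu> \<notin> normal_space ?TM i ?F u"
    "gaussian_curvature (induced_metric ?TM i ?F) u = 0"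
    if "u \<in> regular_points ?TM ?D ?F" "i \<in> charts ?TM" "?F u \<in> chart_dom ?TM i" for u i \<nu> v w
  proof -
    have i: "i \<in> charts M" using that by (simp add: tangent_bundle_def)
    have D: "u $ 1 \<in> D" and inj: "inj (tangent_map ?TM i ?F u)" using that by (auto simp: regular_points_def)
    then have u: "u $ 1 \<in> {s \<in> D. \<gamma> s \<in> chart_dom M i}"
      using that(3) cylinder_mem_chart_dom[OF assms(1,5) D] by simp
    note at = cylinder_totally_geodesic_flat_at[OF cylinder_chartI[OF assms(1) i assms(4-8)] u inj]
    from at show "second_fundamental_form ?TM i ?F u \<nu> v w = 0 \<or> \<nu> \<notin> normal_space ?TM i ?F u"
      "gaussian_curvature (induced_metric ?TM i ?F) u = 0" by blast+
  qed
  then show ?thesis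
    using smooth unfolding totally_geodesic_surface_def intrinsically_flat_surface_def by blast
qed

end
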